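(* Let $P$ be a $d$-dimensional permutation matrix and let $k_1,\ldots,k_d$ be positive integers at least two of which are greater than $1$. Let $$\alpha(k_1,\ldots,k_d)=\frac{\max(k_1,\ldots,k_d)}{k_1\cdot k_2\cdots k_d},\qquad \beta(k_1,\ldots,k_d)=\frac{k_1+\cdots+k_d-d}{k_1\cdot k_2\cdots k_d-1}.$$ Then there exist positive constants $C_1$ and $C_2$ such that for all positive integers $n$, $$C_1 n^{d-\beta(k_1,\ldots,k_d)}\le f(n,P\otimes R^{k_1,\ldots,k_d},d)\le C_2 n^{d-\alpha(k_1,\ldots,k_d)}.$$
   Context: A $d$-dimensional $n_1\times\cdots\times n_d$ zero-one matrix is an array $A=(a_{i_1,\ldots,i_d})$, $1\le i_\ell\le n_\ell$, with entries in $\{0,1\}$. A submatrix is obtained by selecting, for each $\ell$, a set of values of the $\ell$-th coordinate (keeping the order). $A$ contains a $d$-dimensional zero-one matrix $B$ if some submatrix of $A$ can be transformed into $B$ by changing any number of ones to zeros; otherwise $A$ avoids $B$. $f(n,B,d)$ denotes the maximum number of ones in a $d$-dimensional $n\times\cdots\times n$ zero-one matrix that avoids $B$. An $\ell$-cross section is the set of all entries having a fixed value of the $\ell$-th coordinate. A $d$-dimensional $k\times\cdots\times k$ zero-one matrix is a permutation matrix if each of its $\ell$-cross sections contains exactly one nonzero entry, for every $\ell=1,\ldots,d$. $R^{k_1,\ldots,k_d}$ is the $k_1\times\cdots\times k_d$ matrix of all ones. The Kronecker product $M\otimes N$ of two $d$-dimensional zero-one matrices is obtained by replacing each $1$-entry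 of $M$ by a copy of $N$ and each $0$-entry of $M$ by a zero matrix of the same size as $N$. *)

theory Defs
  imports Complex_Main "HOL-Library.FuncSet" "HOL-Library.Infinite_Set"
begin

text \<open>
  The dimension \<open>d\<close> is a natural number; the coordinates are numbered \<open>0, \<dots>, d - 1\<close>, and the
  values of each coordinate are counted from \<open>0\<close>.  The side lengths of a matrix are given by a
  function \<open>n\<close> of which only the values \<open>n l\<close> with \<open>l < d\<close> matter.  Indices and matrices are
  extensional functions, so that two matrices of the same shape are equal iff all their entries
  agree.
\<close>

definition index_set :: "nat \<Rightarrow> (nat \<Rightarrow> nat) \<Rightarrow> (nat \<Rightarrow> nat) set" where
  "index_set d n = (\<Pi>\<^sub>E l\<in>{..<d}. {..<n l})"

definition zero_one_matrix :: "nat \<Rightarrow> (nat \<Rightarrow> nat) \<Rightarrow> ((nat \<Rightarrow> nat) \<Rightarrow> nat) \<Rightarrow> bool" where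
  "zero_one_matrix d n A \<longleftrightarrow> A \<in> index_set d n \<rightarrow>\<^sub>E {0, 1}"

definition num_ones :: "nat \<Rightarrow> (nat \<Rightarrow> nat) \<Rightarrow> ((nat \<Rightarrow> nat) \<Rightarrow> nat) \<Rightarrow> nat" where
  "num_ones d n A = card {i \<in> index_set d n. A i = 1}"

text \<open>
  \<open>S l\<close> is the finite set of selected values of coordinate \<open>l\<close>; \<open>enumerate (S l) j\<close> is its
  \<open>j\<close>-th smallest element, counted from \<open>0\<close>.
\<close>

definition submatrix ::
  "nat \<Rightarrow> (nat \<Rightarrow> nat set) \<Rightarrow> ((nat \<Rightarrow> nat) \<Rightarrow> nat) \<Rightarrow> ((nat \<Rightarrow> nat) \<Rightarrow> nat)" where
  "submatrix d S A =
    (\<lambda>i\<in>index_set d (\<lambda>l. card (S l)). A (\<lambda>l\<in>{..<d}. enumerate (S l) (i l)))"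

text \<open>\<open>B\<close> arises from \<open>A\<close> (both of shape \<open>m\<close>) by changing any number of ones to zeros.\<close>

definition ones_to_zeros ::
  "nat \<Rightarrow> (nat \<Rightarrow> nat) \<Rightarrow> ((nat \<Rightarrow> nat) \<Rightarrow> nat) \<Rightarrow> ((nat \<Rightarrow> nat) \<Rightarrow> nat) \<Rightarrow> bool" where
  "ones_to_zeros d m A B \<longleftrightarrow> (\<forall>i\<in>index_set d m. B i = A i \<or> (A i = 1 \<and> B i = 0))"

text \<open>Here \<open>A\<close> has shape \<open>n\<close> and \<open>B\<close> has shape \<open>m\<close>.\<close>

definition contains_matrix ::
  "nat \<Rightarrow> (nat \<Rightarrow> nat) \<Rightarrow> ((nat \<Rightarrow> nat) \<Rightarrow> nat) \<Rightarrow> (nat \<Rightarrow> nat) \<Rightarrow> ((nat \<Rightarrow> nat) \<Rightarrow> nat) \<Rightarrow> bool" where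
  "contains_matrix d n A m B \<longleftrightarrow>
    (\<exists>S. (\<forall>l<d. S l \<subseteq> {..<n l} \<and> card (S l) = m l) \<and> ones_to_zeros d m (submatrix d S A) B)"

abbreviation avoids_matrix ::
  "nat \<Rightarrow> (nat \<Rightarrow> nat) \<Rightarrow> ((nat \<Rightarrow> nat) \<Rightarrow> nat) \<Rightarrow> (nat \<Rightarrow> nat) \<Rightarrow> ((nat \<Rightarrow> nat) \<Rightarrow> nat) \<Rightarrow> bool" where
  "avoids_matrix d n A m B \<equiv> \<not> contains_matrix d n A m B"

text \<open>
  \<open>f(n, B, d)\<close> for a matrix \<open>B\<close> of shape \<open>m\<close>.  The set under \<open>Max\<close> is finite, and it is nonempty
  whenever \<open>B\<close> has at least one nonzero entry, since then the zero matrix avoids \<open>B\<close>.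
\<close>

definition max_ones :: "nat \<Rightarrow> (nat \<Rightarrow> nat) \<Rightarrow> ((nat \<Rightarrow> nat) \<Rightarrow> nat) \<Rightarrow> nat \<Rightarrow> nat" where
  "max_ones n m B d =
    Max {num_ones d (\<lambda>_. n) A | A.
          zero_one_matrix d (\<lambda>_. n) A \<and> avoids_matrix d (\<lambda>_. n) A m B}"

definition cross_section :: "nat \<Rightarrow> (nat \<Rightarrow> nat) \<Rightarrow> nat \<Rightarrow> nat \<Rightarrow> (nat \<Rightarrow> nat) set" where
  "cross_section d n l c = {i \<in> index_set d n. i l = c}"

definition permutation_matrix :: "nat \<Rightarrow> nat \<Rightarrow> ((nat \<Rightarrow> nat) \<Rightarrow> nat) \<Rightarrow> bool" where
  "permutation_matrix d k P \<longleftrightarrow>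
    zero_one_matrix d (\<lambda>_. k) P \<and>
    (\<forall>l<d. \<forall>c<k. \<exists>!i. i \<in> cross_section d (\<lambda>_. k) l c \<and> P i \<noteq> 0)"

definition all_ones_matrix :: "nat \<Rightarrow> (nat \<Rightarrow> nat) \<Rightarrow> ((nat \<Rightarrow> nat) \<Rightarrow> nat)" where
  "all_ones_matrix d k = (\<lambda>i\<in>index_set d k. 1)"

text \<open>
  The Kronecker product of \<open>M\<close> of shape \<open>m\<close> and \<open>N\<close> of shape \<open>q\<close>, of shape \<open>\<lambda>l. m l * q l\<close>.
  The entry at \<open>i\<close> lies in the block with index \<open>i l div q l\<close>, at position \<open>i l mod q l\<close>.
\<close>

definition kronecker_product ::
  "nat \<Rightarrow> (nat \<Rightarrow> nat) \<Rightarrow> ((nat \<Rightarrow> nat) \<Rightarrow> nat) \<Rightarrow> (nat \<Rightarrow> nat) \<Rightarrow> ((nat \<Rightarrow> nat) \<Rightarrow> nat) \<Rightarrow>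
    ((nat \<Rightarrow> nat) \<Rightarrow> nat)" where
  "kronecker_product d m M q N =
    (\<lambda>i\<in>index_set d (\<lambda>l. m l * q l).
      if M (\<lambda>l\<in>{..<d}. i l div q l) = 1 then N (\<lambda>l\<in>{..<d}. i l mod q l) else 0)"

definition alpha :: "nat \<Rightarrow> (nat \<Rightarrow> nat) \<Rightarrow> real" where
  "alpha d k = real (Max (k ` {..<d})) / (\<Prod>l<d. real (k l))"

definition beta :: "nat \<Rightarrow> (nat \<Rightarrow> nat) \<Rightarrow> real" where
  "beta d k = ((\<Sum>l<d. real (k l)) - real d) / ((\<Prod>l<d. real (k l)) - 1)"

end

theory Submission
  imports Defs
begin

text \<open>
  Lower bound: \<open>P \<otimes> R\<close> contains \<open>R\<close>, and keeping each entry with probability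
  \<open>n powr (- \<beta>) / 2\<close> and then deleting one entry from every copy of \<open>R\<close> leaves enough ones.

  Upper bound: cut an array of side length \<open>T * s\<close> into \<open>T ^ d\<close> blocks of side length \<open>s\<close>.  The
  blocks that contain \<open>R\<close> form an array that avoids \<open>P\<close>, so by the theorem of Klazar and Marcus
  there are \<open>O(T ^ (d - 1))\<close> of them; every other block has \<open>O(s powr (d - \<alpha>))\<close> ones.  Hence
  \<open>f(T * s, P \<otimes> R) \<le> c * T ^ (d - 1) * f(s, P \<otimes> R) + T ^ d * O(s powr (d - \<alpha>))\<close>, and because
  \<open>\<alpha> < 1\<close> the induction on the number of levels closes once the constant \<open>T\<close> is large.
\<close>

section \<open>Permutation patterns\<close>

text \<open>The permutation matrix affects only the constants. Copies of \<open>R\<close> found in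
  different blocks need not be aligned, because two ones of \<open>P\<close> never share a cross
  section; it suffices that the blocks themselves are ordered like the ones of \<open>P\<close>. The
  exponent \<open>alpha\<close> is that of the Erdos box theorem: in its induction on the dimension
  one coordinate stays outside the product, and leaving out a largest factor turns 1 / product into
  max / product. A second factor greater than 1 keeps this exponent at most 1/2. That gap absorbs
  the constant c of Klazar and Marcus: the blocks containing \<open>R\<close> contribute c * T^(d -
  1), the target grows by T powr (d - alpha), and the quotient c / T powr (1 - alpha) drops below
  1/2. The exponent \<open>beta\<close> balances the expected q * n^d ones against at most n^(sum of
  the k l) boxes, each surviving with probability q^(product of the k l). Klazar-Marcus is proved by
  induction on the set of coordinates. Hence the combinatorics is done for sets of points over any
  finite coordinate set \<open>D\<close>, and matrices enter only at the end.\<close>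

definition block :: "nat \<Rightarrow> nat set \<Rightarrow> (nat \<Rightarrow> nat) \<Rightarrow> nat \<Rightarrow> nat" where
  "block s D a = (\<lambda>l\<in>D. a l div s)"

definition residue :: "nat \<Rightarrow> nat set \<Rightarrow> (nat \<Rightarrow> nat) \<Rightarrow> nat \<Rightarrow> nat" where
  "residue s D a = (\<lambda>l\<in>D. a l mod s)"

abbreviation fibre :: "nat \<Rightarrow> nat set \<Rightarrow> (nat \<Rightarrow> nat) set \<Rightarrow> (nat \<Rightarrow> nat) \<Rightarrow> (nat \<Rightarrow> nat) set" where
  "fibre s D A b \<equiv> {a \<in> A. block s D a = b}"

lemma block_in_cube:
  assumes "A \<subseteq> PiE D (\<lambda>_. {..<s * N})"
  shows "block s D ` A \<subseteq> PiE D (\<lambda>_. {..<N})"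
proof (intro image_subsetI PiE_I)
  fix a l assume "a \<in> A" "l \<in> D"
  then have "a l < s * N" using assms by (auto simp: PiE_iff)
  then show "block s D a l \<in> {..<N}"
    using \<open>l \<in> D\<close> by (simp add: block_def less_mult_imp_div_less mult.commute)
qed (auto simp: block_def)

lemma block_residue_eqI:
  assumes "x \<in> extensional D" "y \<in> extensional D"
    and "block s D x = block s D y" "residue s D x = residue s D y"
  shows "x = y"
proof (rule extensionalityI[OF assms(1,2)])
  fix l assume "l \<in> D"
  then have "x l div s = y l div s" "x l mod s = y l mod s"
    using fun_cong[OF assms(3), of l] fun_cong[OF assms(4), of l]
    by (simp_all add: block_def residue_def)
  then show "x l = y l" by (metis div_mult_mod_eq)
qed

lemma inj_on_residue_fibre:
  assumes "A \<subseteq> extensional D"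
  shows "inj_on (residue s D) (fibre s D A b)"
proof (rule inj_onI)
  fix x y assume "x \<in> fibre s D A b" "y \<in> fibre s D A b" "residue s D x = residue s D y"
  then show "x = y" using assms by (intro block_residue_eqI[of x D y s]) (simp_all add: subset_iff)
qed

lemma card_le_image_mult:
  assumes "finite A" "\<And>b. b \<in> f ` A \<Longrightarrow> card {a \<in> A. f a = b} \<le> m"
  shows "card A \<le> card (f ` A) * m"
proof -
  have "A = (\<Union>b\<in>f ` A. {a \<in> A. f a = b})" by auto
  then have "card A = card (\<Union>b\<in>f ` A. {a \<in> A. f a = b})" by simp
  also have "\<dots> \<le> (\<Sum>b\<in>f ` A. card {a \<in> A. f a = b})"
    using assms(1) by (intro card_UN_le) auto
  also have "\<dots> \<le> of_nat (card (f ` A)) * m" by (intro sum_bounded_above assms(2))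
  finally show ?thesis by simp
qed

lemma card_UN_le_mult:
  assumes "finite I" "\<And>i. i \<in> I \<Longrightarrow> card (F i) \<le> m"
  shows "card (\<Union>i\<in>I. F i) \<le> card I * m"
proof -
  have "card (\<Union>i\<in>I. F i) \<le> (\<Sum>i\<in>I. card (F i))" by (intro card_UN_le assms)
  also have "\<dots> \<le> of_nat (card I) * m" by (intro sum_bounded_above assms(2))
  finally show ?thesis by simp
qed

lemma card_le_fibres:
  assumes "A \<subseteq> PiE D (\<lambda>_. {..<s * N})" "finite D" "s > 0"
  shows "card A \<le> card (block s D ` A) * s ^ card D"
proof (rule card_le_image_mult)
  show "finite A" by (rule finite_subset[OF assms(1)]) (simp add: finite_PiE assms(2))
next
  fix b
  have "card (fibre s D A b) = card (residue s D ` fibre s D A b)"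
    using assms(1) by (intro card_image[symmetric] inj_on_residue_fibre) (auto simp: PiE_def)
  also have "\<dots> \<le> card (PiE D (\<lambda>_. {..<s}))"
    using assms by (intro card_mono finite_PiE) (auto simp: residue_def)
  finally show "card (fibre s D A b) \<le> s ^ card D" using assms(2) by (simp add: card_PiE)
qed

text \<open>
  The points \<open>y j\<close>, \<open>j < p\<close>, form a copy of the permutation matrix whose \<open>j\<close>-th one has
  coordinates \<open>\<pi> l j\<close>.  Ordering the coordinates only where \<open>\<pi>\<close> separates them makes a
  lower-dimensional projection of the pattern just a restriction of \<open>D\<close>.
\<close>

definition has_pattern :: "nat set \<Rightarrow> nat \<Rightarrow> (nat \<Rightarrow> nat \<Rightarrow> nat) \<Rightarrow> (nat \<Rightarrow> nat) set \<Rightarrow> bool" where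
  "has_pattern D p \<pi> A \<longleftrightarrow> (\<exists>y. (\<forall>j<p. y j \<in> A) \<and>
    (\<forall>l\<in>D. \<forall>i<p. \<forall>j<p. \<pi> l i < \<pi> l j \<longrightarrow> y i l < y j l))"

lemma has_patternI:
  assumes "\<And>j. j < p \<Longrightarrow> y j \<in> A"
    "\<And>l i j. \<lbrakk>l \<in> D; i < p; j < p; \<pi> l i < \<pi> l j\<rbrakk> \<Longrightarrow> y i l < y j l"
  shows "has_pattern D p \<pi> A"
  using assms unfolding has_pattern_def by blast

lemma has_patternE:
  assumes "has_pattern D p \<pi> A"
  obtains y where "\<And>j. j < p \<Longrightarrow> y j \<in> A"
    "\<And>l i j. \<lbrakk>l \<in> D; i < p; j < p; \<pi> l i < \<pi> l j\<rbrakk> \<Longrightarrow> y i l < y j l"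
  using assms unfolding has_pattern_def by blast

lemma div_less_imp_less: "(x::nat) div s < y div s \<Longrightarrow> x < y"
  by (meson div_le_mono leD leI)

text \<open>Quotients that are strictly ordered force the same order on the numbers, so one
  representative per block is enough. This is how an array of blocks inherits avoidance.\<close>

lemma has_pattern_blocks:
  assumes "has_pattern D p \<pi> B" "B \<subseteq> block s D ` A"
  shows "has_pattern D p \<pi> A"
proof -
  obtain y where y: "\<And>j. j < p \<Longrightarrow> y j \<in> B"
    "\<And>l i j. \<lbrakk>l \<in> D; i < p; j < p; \<pi> l i < \<pi> l j\<rbrakk> \<Longrightarrow> y i l < y j l"
    using assms(1) by (rule has_patternE) blast
  have "\<forall>j\<in>{..<p}. \<exists>a. a \<in> A \<and> block s D a = y j"
  proof
    fix j assume "j \<in> {..<p}"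
    then have "y j \<in> block s D ` A" using subsetD[OF assms(2) y(1)] by simp
    then show "\<exists>a. a \<in> A \<and> block s D a = y j" by auto
  qed
  from bchoice[OF this] obtain z where z: "\<And>j. j < p \<Longrightarrow> z j \<in> A \<and> block s D (z j) = y j"
    by auto
  show ?thesis
  proof (rule has_patternI)
    fix l i j assume *: "l \<in> D" "i < p" "j < p" "\<pi> l i < \<pi> l j"
    then have "z i l div s < z j l div s"
      using y(2)[OF *] z[OF *(2), THEN conjunct2, THEN fun_cong, of l]
        z[OF *(3), THEN conjunct2, THEN fun_cong, of l] *(1) by (simp add: block_def)
    then show "z i l < z j l" by (rule div_less_imp_less)
  qed (use z in blast)
qed

text \<open>
  The Marcus--Tardos argument.  Blocks in which every coordinate takes fewer than \<open>p\<close> values hold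
  few points and themselves form an array that avoids the pattern.  Among the other blocks, those in
  one layer \<open>b l = v\<close> with the same set \<open>T\<close> of at least \<open>p\<close> values of coordinate \<open>l\<close> avoid the
  projected pattern, because coordinate \<open>l\<close> can be chosen freely in \<open>T\<close>.
\<close>

lemma marcus_tardos_recursion:
  assumes D: "finite D" and \<pi>: "\<And>l j. \<lbrakk>l \<in> D; j < p\<rbrakk> \<Longrightarrow> \<pi> l j < p"
    and A: "A \<subseteq> PiE D (\<lambda>_. {..<s * N})" and s: "s > 0" and avoids: "\<not> has_pattern D p \<pi> A"
    and f: "\<And>B. \<lbrakk>B \<subseteq> PiE D (\<lambda>_. {..<N}); \<not> has_pattern D p \<pi> B\<rbrakk> \<Longrightarrow> card B \<le> f"
    and g: "\<And>l B. \<lbrakk>l \<in> D; B \<subseteq> PiE (D - {l}) (\<lambda>_. {..<N}); \<not> has_pattern (D - {l}) p \<pi> B\<rbrakk>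
      \<Longrightarrow> card B \<le> g"
  shows "card A \<le> f * p ^ card D + card D * (N * (2 ^ s * g) * s ^ card D)"
proof -
  define T where "T l b = (\<lambda>a. a l mod s) ` fibre s D A b" for l b
  define W where "W l = {b \<in> block s D ` A. p \<le> card (T l b)}" for l
  define A0 where "A0 = {a \<in> A. \<forall>l\<in>D. block s D a \<notin> W l}"
  define A1 where "A1 l = {a \<in> A. block s D a \<in> W l}" for l
  have ext: "A \<subseteq> extensional D" using A by (auto simp: PiE_def)
  have finA: "finite A" by (rule finite_subset[OF A]) (simp add: finite_PiE D)
  have T_sub: "T l b \<subseteq> {..<s}" for l b using s by (auto simp: T_def)
  have "card A0 \<le> card (block s D ` A0) * p ^ card D"
  proof (rule card_le_image_mult)
    fix b assume b: "b \<in> block s D ` A0"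
    have "card {a \<in> A0. block s D a = b} \<le> card (fibre s D A b)"
      using finA by (intro card_mono) (auto simp: A0_def)
    also have "\<dots> = card (residue s D ` fibre s D A b)"
      by (intro card_image[symmetric] inj_on_residue_fibre ext)
    \<comment> \<open>A block that is wide in no direction fits, by residues, into a product of sets
      with fewer than \<open>p\<close> elements each.\<close>
    also have "\<dots> \<le> card (PiE D (\<lambda>l. T l b))"
      using D by (intro card_mono finite_PiE finite_subset[OF T_sub])
        (auto simp: residue_def T_def)
    also have "\<dots> = (\<Prod>l\<in>D. card (T l b))" using D by (simp add: card_PiE)
    also have "\<dots> \<le> (\<Prod>l\<in>D. p)"
      using b by (intro prod_mono) (auto simp: W_def A0_def not_le less_imp_le)
    finally show "card {a \<in> A0. block s D a = b} \<le> p ^ card D" by simp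
  qed (use finA in \<open>simp add: A0_def\<close>)
  also have "\<dots> \<le> f * p ^ card D"
  proof (intro mult_right_mono f)
    show "block s D ` A0 \<subseteq> PiE D (\<lambda>_. {..<N})"
      using A by (intro block_in_cube) (auto simp: A0_def)
    show "\<not> has_pattern D p \<pi> (block s D ` A0)"
      using avoids has_pattern_blocks[of D p \<pi> "block s D ` A0" s A] by (auto simp: A0_def)
  qed simp
  finally have A0: "card A0 \<le> f * p ^ card D" .
  have A1: "card (A1 l) \<le> N * (2 ^ s * g) * s ^ card D" if l: "l \<in> D" for l
  proof -
    define V where "V v U = {b \<in> W l. b l = v \<and> T l b = U}" for v U
    have W_cube: "W l \<subseteq> PiE D (\<lambda>_. {..<N})"
      using block_in_cube[OF A] by (auto simp: W_def)
    have V: "card (V v U) \<le> g" for v U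
    proof (cases "V v U = {}")
      case False
      then have U: "U \<subseteq> {..<s}" "p \<le> card U" using T_sub by (auto simp: V_def W_def)
      then have finU: "finite U" by (auto intro: finite_subset)
      \<comment> \<open>The layer \<open>v\<close> fixes coordinate \<open>l\<close>, so forgetting
        it loses nothing.\<close>
      have "inj_on (\<lambda>b. restrict b (D - {l})) (V v U)"
      proof (rule inj_onI)
        fix x y assume x: "x \<in> V v U" and y: "y \<in> V v U"
          and eq: "restrict x (D - {l}) = restrict y (D - {l})"
        have "x i = y i" if "i \<in> D" for i
          using x y that fun_cong[OF eq, of i] by (cases "i = l") (auto simp: V_def)
        moreover have "x \<in> extensional D" "y \<in> extensional D"
          using x y W_cube by (auto simp: V_def PiE_def)
        ultimately show "x = y" by (intro extensionalityI[of _ D])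
      qed
      then have "card (V v U) = card ((\<lambda>b. restrict b (D - {l})) ` V v U)"
        by (rule card_image[symmetric])
      also have "\<dots> \<le> g"
      proof (intro g[OF l] notI)
        show "(\<lambda>b. restrict b (D - {l})) ` V v U \<subseteq> PiE (D - {l}) (\<lambda>_. {..<N})"
          using W_cube by (force simp: V_def PiE_iff)
        assume "has_pattern (D - {l}) p \<pi> ((\<lambda>b. restrict b (D - {l})) ` V v U)"
        then obtain y where y: "\<And>j. j < p \<Longrightarrow> y j \<in> (\<lambda>b. restrict b (D - {l})) ` V v U"
          "\<And>i j m. \<lbrakk>m \<in> D - {l}; i < p; j < p; \<pi> m i < \<pi> m j\<rbrakk> \<Longrightarrow> y i m < y j m"
          by (rule has_patternE) blast
        \<comment> \<open>In the block above \<open>y j\<close> every residue in \<open>U\<close>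
          occurs in direction \<open>l\<close>; taking the \<open>\<pi> l j\<close>-th smallest
          restores the order that the projection lost. The residues are comparable because all these
          blocks share \<open>U\<close> and the layer \<open>v\<close>.\<close>
        have "\<forall>j. \<exists>a. j < p \<longrightarrow> a \<in> A \<and> restrict (block s D a) (D - {l}) = y j
            \<and> block s D a l = v \<and> a l mod s = enumerate U (\<pi> l j)"
        proof (intro allI)
          fix j
          show "\<exists>a. j < p \<longrightarrow> a \<in> A \<and> restrict (block s D a) (D - {l}) = y j
            \<and> block s D a l = v \<and> a l mod s = enumerate U (\<pi> l j)"
          proof (cases "j < p")
            case True
            obtain b where b: "b \<in> V v U" "y j = restrict b (D - {l})" using y(1)[OF True] by blast
            have "\<pi> l j < card U" using \<pi>[OF l True] U by simp
            then have "enumerate U (\<pi> l j) \<in> T l b"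
              using finite_enumerate_in_set[OF finU] b by (auto simp: V_def)
            then show ?thesis using b by (auto simp: T_def V_def)
          qed simp
        qed
        then obtain z where z: "\<And>j. j < p \<Longrightarrow> z j \<in> A \<and> restrict (block s D (z j)) (D - {l}) = y j
            \<and> block s D (z j) l = v \<and> z j l mod s = enumerate U (\<pi> l j)" by metis
        have "has_pattern D p \<pi> A"
        proof (rule has_patternI)
          fix m i j assume *: "m \<in> D" "i < p" "j < p" "\<pi> m i < \<pi> m j"
          show "z i m < z j m"
          proof (cases "m = l")
            case True
            have "z i l div s = z j l div s"
              using z[OF *(2)] z[OF *(3)] l by (simp add: block_def)
            moreover have "enumerate U (\<pi> l i) < enumerate U (\<pi> l j)"
              using * True U \<pi>[OF l] finU by (intro finite_enumerate_mono) (auto intro: less_le_trans)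
            then have "z i l mod s < z j l mod s" using z * by simp
            ultimately show ?thesis unfolding True
              by (metis div_mult_mod_eq nat_add_left_cancel_less)
          next
            case False
            then have m: "m \<in> D - {l}" using * by simp
            then have "z i m div s < z j m div s"
              using y(2)[OF m *(2-)] z[OF *(2), THEN conjunct2, THEN conjunct1, THEN fun_cong, of m]
                z[OF *(3), THEN conjunct2, THEN conjunct1, THEN fun_cong, of m]
              by (simp add: block_def)
            then show ?thesis by (rule div_less_imp_less)
          qed
        qed (use z in blast)
        then show False using avoids by contradiction
      qed
      finally show ?thesis .
    qed simp
    have W_sub: "W l \<subseteq> (\<Union>v\<in>{..<N}. \<Union>U\<in>Pow {..<s}. V v U)"
      using W_cube T_sub l by (auto simp: V_def PiE_iff)
    have "card (A1 l) \<le> card (block s D ` A1 l) * s ^ card D"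
      using A D s by (intro card_le_fibres[where N = N]) (auto simp: A1_def)
    also have "block s D ` A1 l = W l" by (auto simp: A1_def W_def)
    also have "card (W l) \<le> card (\<Union>v\<in>{..<N}. \<Union>U\<in>Pow {..<s}. V v U)"
    proof (intro card_mono W_sub finite_UN_I)
      show "finite (V v U)" for v U
        using finA by (rule finite_subset[rotated, OF finite_imageI[of A "block s D"]])
          (auto simp: V_def W_def)
    qed auto
    also have "\<dots> \<le> card {..<N} * (card (Pow {..<s}) * g)"
      by (intro card_UN_le_mult V) auto
    finally show ?thesis by (simp add: card_Pow)
  qed
  have "A \<subseteq> A0 \<union> (\<Union>l\<in>D. A1 l)" by (auto simp: A0_def A1_def)
  moreover have "finite (A0 \<union> (\<Union>l\<in>D. A1 l))"
    using finA D by (auto simp: A0_def A1_def)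
  ultimately have "card A \<le> card (A0 \<union> (\<Union>l\<in>D. A1 l))" by (metis card_mono)
  also have "\<dots> \<le> card A0 + card (\<Union>l\<in>D. A1 l)" by (rule card_Un_le)
  also have "\<dots> \<le> f * p ^ card D + card D * (N * (2 ^ s * g) * s ^ card D)"
    using D by (intro add_mono A0 card_UN_le_mult A1)
  finally show ?thesis .
qed

text \<open>Base case of the induction on the coordinate set: distinct points have distinct values,
  and point \<open>j\<close> of the pattern takes the \<open>\<pi> l j\<close>-th smallest
  one.\<close>

lemma one_dimensional_pattern:
  assumes A: "A \<subseteq> extensional {l}" "finite A" and \<pi>: "\<And>j. j < p \<Longrightarrow> \<pi> l j < p"
    and avoids: "\<not> has_pattern {l} p \<pi> A"
  shows "card A \<le> p"
proof (rule ccontr)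
  assume "\<not> card A \<le> p"
  define U where "U = (\<lambda>a. a l) ` A"
  have "inj_on (\<lambda>a. a l) A"
    using A by (auto intro!: inj_onI extensionalityI[of _ "{l}"])
  then have U: "finite U" "p \<le> card U" 
    using \<open>\<not> card A \<le> p\<close> A by (auto simp: U_def card_image)
  have "\<forall>j. \<exists>a. j < p \<longrightarrow> a \<in> A \<and> a l = enumerate U (\<pi> l j)"
    using finite_enumerate_in_set[OF U(1)] U(2) \<pi> unfolding U_def
    by (metis (no_types, lifting) image_iff less_le_trans)
  then obtain z where z: "\<And>j. j < p \<Longrightarrow> z j \<in> A \<and> z j l = enumerate U (\<pi> l j)" by metis
  have "has_pattern {l} p \<pi> A"
  proof (rule has_patternI)
    fix m i j assume *: "m \<in> {l}" "i < p" "j < p" "\<pi> m i < \<pi> m j"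
    then show "z i m < z j m"
      using z U \<pi> by (auto intro!: finite_enumerate_mono intro: less_le_trans)
  qed (use z in blast)
  then show False using avoids by contradiction
qed

text \<open>The outer induction on \<open>D\<close> supplies the bound for the projected patterns,
  the inner one on \<open>t\<close> iterates the recursion with blocks of fixed side
  \<open>(p + 1)^2\<close>. This side is chosen so that the gain \<open>s ^ (card D - 1)\<close> of
  one level exceeds the factor \<open>p ^ card D\<close> lost on narrow blocks. Sides that are
  powers of one number avoid rounding.\<close>

theorem klazar_marcus:
  assumes "finite D" "D \<noteq> {}" "\<And>l j. \<lbrakk>l \<in> D; j < p\<rbrakk> \<Longrightarrow> \<pi> l j < p"
  shows "\<exists>c. \<forall>t. \<forall>A. A \<subseteq> PiE D (\<lambda>_. {..<((p + 1)\<^sup>2) ^ t}) \<longrightarrow> \<not> has_pattern D p \<pi> A \<longrightarrow>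
    card A \<le> c * (((p + 1)\<^sup>2) ^ t) ^ (card D - 1)"
  using assms
proof (induction D rule: finite_psubset_induct)
  case (psubset D)
  define s where "s = (p + 1)\<^sup>2"
  have s: "s > 0" by (simp add: s_def)
  show ?case
  proof (cases "\<exists>l. D = {l}")
    case True
    then obtain l where l: "D = {l}" by blast
    have "card A \<le> p" if "A \<subseteq> PiE D (\<lambda>_. {..<((p + 1)\<^sup>2) ^ t})" "\<not> has_pattern D p \<pi> A" for A t
    proof (rule one_dimensional_pattern)
      show "finite A" by (rule finite_subset[OF that(1)]) (simp add: finite_PiE l)
    qed (use that psubset.prems l in \<open>auto simp: PiE_def\<close>)
    then show ?thesis by (intro exI[of _ p]) (simp add: l)
  next
    case False
    define d where "d = card D - 2"
    have "card D \<noteq> 1" using False by (auto simp: card_1_singleton_iff)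
    moreover have "card D \<noteq> 0" using psubset by simp
    ultimately have d: "card D = d + 2" by (simp add: d_def)
    have "\<forall>l. \<exists>c. l \<in> D \<longrightarrow> (\<forall>t. \<forall>A. A \<subseteq> PiE (D - {l}) (\<lambda>_. {..<s ^ t}) \<longrightarrow>
      \<not> has_pattern (D - {l}) p \<pi> A \<longrightarrow> card A \<le> c * (s ^ t) ^ d)"
    proof (intro allI)
      fix l
      show "\<exists>c. l \<in> D \<longrightarrow> (\<forall>t. \<forall>A. A \<subseteq> PiE (D - {l}) (\<lambda>_. {..<s ^ t}) \<longrightarrow>
      \<not> has_pattern (D - {l}) p \<pi> A \<longrightarrow> card A \<le> c * (s ^ t) ^ d)"
      proof (cases "l \<in> D")
        case True
        then have "D - {l} \<noteq> {}" "card (D - {l}) - 1 = d"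
          using False d psubset.hyps by auto
        then show ?thesis
          using psubset.IH[of "D - {l}"] psubset.prems True unfolding s_def by auto
      qed simp
    qed
    then obtain g where g: "\<And>l t A. \<lbrakk>l \<in> D; A \<subseteq> PiE (D - {l}) (\<lambda>_. {..<s ^ t});
      \<not> has_pattern (D - {l}) p \<pi> A\<rbrakk> \<Longrightarrow> card A \<le> g l * (s ^ t) ^ d" by metis
    define g' where "g' = (\<Sum>l\<in>D. g l)"
    have g': "card A \<le> g' * (s ^ t) ^ d" if "l \<in> D" "A \<subseteq> PiE (D - {l}) (\<lambda>_. {..<s ^ t})"
      "\<not> has_pattern (D - {l}) p \<pi> A" for l t A
    proof -
      have "g l \<le> g'" unfolding g'_def using that psubset.hyps by (intro member_le_sum) auto
      then show ?thesis using g[OF that] by (meson le_trans mult_le_mono1)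
    qed
    \<comment> \<open>The added 1 covers the cube with a single point; \<open>c - 1\<close> is
      exactly the coefficient that the wide blocks contribute.\<close>
    define c where "c = card D * (2 ^ s * g') * s ^ card D + 1"
    have "card A \<le> c * (s ^ t) ^ (d + 1)"
      if "A \<subseteq> PiE D (\<lambda>_. {..<s ^ t})" "\<not> has_pattern D p \<pi> A" for A t
      using that
    proof (induction t arbitrary: A)
      case 0
      have "card A \<le> card (PiE D (\<lambda>_. {..<(1::nat)}))"
        using 0 psubset.hyps by (intro card_mono finite_PiE) auto
      then show ?case by (simp add: c_def card_PiE psubset.hyps)
    next
      case (Suc t)
      let ?N = "s ^ t"
      have "card A \<le> c * ?N ^ (d + 1) * p ^ card D
          + card D * (?N * (2 ^ s * (g' * ?N ^ d)) * s ^ card D)"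
        using Suc psubset.hyps psubset.prems s
        by (intro marcus_tardos_recursion[where \<pi> = \<pi>] g') auto
      also have "\<dots> = (c * p ^ card D + (c - 1)) * ?N ^ (d + 1)"
        by (simp add: c_def algebra_simps)
      also have "\<dots> \<le> (c * s ^ (d + 1)) * ?N ^ (d + 1)"
      proof (intro mult_right_mono)
        have "p ^ card D + 1 \<le> (p + 1) ^ card D"
          using power_strict_mono[of p "p + 1" "card D"] d by simp
        \<comment> \<open>Here squaring \<open>p + 1\<close> pays: \<open>card D = d + 2\<close> is
          at most \<open>2 * (d + 1)\<close>.\<close>
        also have "\<dots> \<le> (p + 1) ^ (2 * (d + 1))" unfolding d by (intro power_increasing) auto
        also have "\<dots> = s ^ (d + 1)" unfolding s_def by (rule power_mult)
        finally have "c * (p ^ card D + 1) \<le> c * s ^ (d + 1)" by (rule mult_left_mono) simp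
        then show "c * p ^ card D + (c - 1) \<le> c * s ^ (d + 1)" by simp
      qed simp
      also have "\<dots> = c * (s ^ Suc t) ^ (d + 1)" by (simp add: algebra_simps power_mult_distrib)
      finally show ?case .
    qed
    then show ?thesis unfolding s_def d by (intro exI[of _ c]) simp
  qed
qed

section \<open>Boxes\<close>

text \<open>Reordering values leaves an all-ones matrix unchanged, so a copy of it is a bare product
  of sets without any order condition.\<close>

definition has_box :: "nat set \<Rightarrow> (nat \<Rightarrow> nat) \<Rightarrow> (nat \<Rightarrow> nat) set \<Rightarrow> bool" where
  "has_box D k A \<longleftrightarrow> (\<exists>S. (\<forall>l\<in>D. card (S l) = k l) \<and> PiE D S \<subseteq> A)"

text \<open>Takes the place of convexity in the double counting. Up to the threshold
  \<open>k * a\<close> nothing is to be shown; beyond it \<open>y choose k\<close> is at least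
  \<open>(y / k) ^ k\<close>, and all but one of these factors can be lowered to
  \<open>a\<close>.\<close>

lemma le_threshold_plus_binomial:
  fixes a :: real
  assumes "k > 0" "a \<ge> 1"
  shows "real y \<le> k * a + k * real (y choose k) / a ^ (k - 1)"
proof (cases "real y \<le> k * a")
  case True
  then show ?thesis using assms by (simp add: add_increasing2)
next
  case False
  then have y: "real k * a < y" by simp
  then have "k < y" using assms by (metis le_less_trans mult_left_mono mult.right_neutral of_nat_0_le_iff of_nat_less_iff)
  have ya: "a \<le> real y / k" using y assms by (simp add: field_simps)
  have "real y * a ^ (k - 1) = k * ((real y / k) * a ^ (k - 1))" using assms by simp
  also have "\<dots> \<le> k * ((real y / k) * (real y / k) ^ (k - 1))"
    using ya assms by (intro mult_left_mono power_mono) auto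
  also have "(real y / k) * (real y / k) ^ (k - 1) = (real y / k) ^ k"
    using assms by (metis power_minus_mult mult.commute)
  also have "k * (real y / k) ^ k \<le> k * real (y choose k)"
    using \<open>k < y\<close> by (intro mult_left_mono binomial_ge_n_over_k_pow_k) auto
  finally have "real y \<le> k * real (y choose k) / a ^ (k - 1)"
    using assms by (simp add: field_simps)
  then show ?thesis using assms by (simp add: add_increasing)
qed

text \<open>
  The theorem of Erdos that generalizes the bound of Kovari, Sos and Turan.  A new coordinate \<open>l\<close> is
  handled by double counting the pairs of a point \<open>x\<close> and a set \<open>V\<close> of \<open>k l\<close> values with
  \<open>x(l := v) \<in> A\<close> for all \<open>v \<in> V\<close>.
\<close>

lemma erdos_box:
  assumes "finite D" "m \<notin> D" "\<And>l. l \<in> insert m D \<Longrightarrow> k l > 0"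
  shows "\<exists>C::real. C > 0 \<and> (\<forall>n>0. \<forall>A. A \<subseteq> PiE (insert m D) (\<lambda>_. {..<n}) \<longrightarrow>
    \<not> has_box (insert m D) k A \<longrightarrow>
    card A \<le> C * real n powr (real (card (insert m D)) - 1 / (\<Prod>l\<in>D. real (k l))))"
  using assms
proof (induction D rule: finite_induct)
  case empty
  \<comment> \<open>Over the single coordinate \<open>m\<close> the exponent is
    \<open>1 - 1 = 0\<close>, so a constant bound is needed; any \<open>k m\<close> points already
    form a box.\<close>
  have "card A \<le> k m" if A: "A \<subseteq> PiE {m} (\<lambda>_. {..<n})" "\<not> has_box {m} k A" for A n
  proof (rule ccontr)
    assume "\<not> card A \<le> k m"
    have ext: "A \<subseteq> extensional {m}" using A by (auto simp: PiE_def)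
    then have "inj_on (\<lambda>a. a m) A" by (auto intro!: inj_onI extensionalityI[of _ "{m}"])
    then have "k m \<le> card ((\<lambda>a. a m) ` A)" using \<open>\<not> card A \<le> k m\<close> by (simp add: card_image)
    then obtain S where S: "S \<subseteq> (\<lambda>a. a m) ` A" "card S = k m"
      using obtain_subset_with_card_n by metis
    have "x \<in> A" if x: "x \<in> PiE {m} (\<lambda>_. S)" for x
    proof -
      obtain a where a: "a \<in> A" "a m = x m" using x S by (auto simp: PiE_iff)
      then have "x = a" using ext x by (intro extensionalityI[of _ "{m}"]) (auto simp: PiE_def)
      then show ?thesis using a by simp
    qed
    then have "has_box {m} k A" unfolding has_box_def using S by (intro exI[of _ "\<lambda>_. S"]) auto
    then show False using A(2) by contradiction
  qed
  then show ?case using empty(2)[of m]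
    by (intro exI[of _ "real (k m)"]) auto
next
  case (insert l D)
  define E where "E = insert m D"
  define q where "q = 1 / (\<Prod>l\<in>D. real (k l))"
  have D_pos: "\<forall>l\<in>insert m D. k l > 0" and kl: "k l > 0" using insert.prems by auto
  have "(\<Prod>l\<in>D. real (k l)) \<ge> 1" using D_pos by (intro prod_ge_1) (simp add: Suc_le_eq)
  then have q: "0 < q" "q \<le> 1" by (auto simp: q_def)
  have lE: "l \<notin> E" and finE: "finite E" using insert by (auto simp: E_def)
  have mD: "m \<notin> D" and kD: "\<And>i. i \<in> insert m D \<Longrightarrow> k i > 0" using insert.prems by auto
  obtain C where *: "C > 0 \<and> (\<forall>n>0. \<forall>A. A \<subseteq> PiE E (\<lambda>_. {..<n}) \<longrightarrow> \<not> has_box E k A \<longrightarrow>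
      card A \<le> C * real n powr (real (card E) - q))"
    using insert.IH[OF mD kD] unfolding E_def q_def by (rule exE)
  note C = *[THEN conjunct1] and IH = *[THEN conjunct2, rule_format]
  have "card A \<le> k l * (1 + C) * real n powr (real (card E) + 1 - q / k l)"
    if n: "n > 0" and A: "A \<subseteq> PiE (insert l E) (\<lambda>_. {..<n})" "\<not> has_box (insert l E) k A" for n A
  proof -
    define X where "X = PiE E (\<lambda>_. {..<n})"
    define N where "N x = {v \<in> {..<n}. x(l := v) \<in> A}" for x
    define Vs where "Vs = {V. V \<subseteq> {..<n} \<and> card V = k l}"
    \<comment> \<open>The threshold that equalizes both terms below: \<open>n ^ card E * a\<close>
      and \<open>n ^ k l * n powr (card E - q) / a ^ (k l - 1)\<close> have the same exponent
      \<open>card E + 1 - q / k l\<close>.\<close>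
    define a where "a = real n powr (1 - q / k l)"
    define e where "e = (1 - q / k l) * (real (k l) - 1)"
    have finX: "finite X" unfolding X_def using finE by (simp add: finite_PiE)
    have finVs: "finite Vs" unfolding Vs_def by simp
    have "q / k l \<le> 1 / 1" using q kl by (intro frac_le) auto
    then have a: "a \<ge> 1" unfolding a_def using n by (intro ge_one_powr_ge_zero) auto
    have cardX: "card X = n ^ card E" by (simp add: X_def card_PiE finE)
    have "A \<subseteq> (\<Union>x\<in>X. (\<lambda>v. x(l := v)) ` N x)"
    proof
      fix y assume y: "y \<in> A"
      then have yP: "y \<in> PiE (insert l E) (\<lambda>_. {..<n})" using A by blast
      then have *: "(restrict y E)(l := y l) = y"
        using lE by (intro extensionalityI[of _ "insert l E"]) (auto simp: PiE_iff extensional_def)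
      have "restrict y E \<in> X" "y l \<in> N (restrict y E)"
        using yP y * by (auto simp: X_def N_def PiE_iff)
      then show "y \<in> (\<Union>x\<in>X. (\<lambda>v. x(l := v)) ` N x)" using * by (metis UN_I imageI)
    qed
    then have "card A \<le> card (\<Union>x\<in>X. (\<lambda>v. x(l := v)) ` N x)"
      using finX by (intro card_mono) (auto simp: N_def)
    also have "\<dots> \<le> (\<Sum>x\<in>X. card ((\<lambda>v. x(l := v)) ` N x))" by (rule card_UN_le[OF finX])
    also have "\<dots> \<le> (\<Sum>x\<in>X. card (N x))" by (intro sum_mono card_image_le) (auto simp: N_def)
    finally have cardA: "card A \<le> (\<Sum>x\<in>X. card (N x))" .
    have "(\<Sum>x\<in>X. card (N x) choose k l) = (\<Sum>x\<in>X. \<Sum>V\<in>Vs. if V \<subseteq> N x then 1 else 0)"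
    proof (rule sum.cong)
      fix x
      have "card (N x) choose k l = card {V. V \<subseteq> N x \<and> card V = k l}"
        by (rule n_subsets[symmetric]) (simp add: N_def)
      also have "{V. V \<subseteq> N x \<and> card V = k l} = {V \<in> Vs. V \<subseteq> N x}"
        by (auto simp: Vs_def N_def)
      finally show "card (N x) choose k l = (\<Sum>V\<in>Vs. if V \<subseteq> N x then 1 else 0)"
        using finVs by (simp add: sum.If_cases Int_def)
    qed simp
    also have "\<dots> = (\<Sum>V\<in>Vs. \<Sum>x\<in>X. if V \<subseteq> N x then 1 else 0)" by (rule sum.swap)
    also have "\<dots> = (\<Sum>V\<in>Vs. card {x \<in> X. V \<subseteq> N x})"
      using finX by (simp add: sum.If_cases Int_def)
    finally have "real (\<Sum>x\<in>X. card (N x) choose k l) = (\<Sum>V\<in>Vs. real (card {x \<in> X. V \<subseteq> N x}))"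
      by simp
    also have "\<dots> \<le> of_nat (card Vs) * (C * real n powr (real (card E) - q))"
    proof (intro sum_bounded_above IH n)
      fix V assume V: "V \<in> Vs"
      \<comment> \<open>A box of points whose lines all meet \<open>A\<close> in \<open>V\<close>
        would, multiplied by \<open>V\<close>, be a box of \<open>A\<close>.\<close>
      show "\<not> has_box E k {x \<in> X. V \<subseteq> N x}"
      proof
        assume "has_box E k {x \<in> X. V \<subseteq> N x}"
        then obtain S where S: "\<forall>i\<in>E. card (S i) = k i" "PiE E S \<subseteq> {x \<in> X. V \<subseteq> N x}"
          unfolding has_box_def by blast
        have "y \<in> A" if y: "y \<in> PiE (insert l E) (S(l := V))" for y
        proof -
          have "restrict y E \<in> PiE E S"
            using y lE by (auto simp: PiE_iff split: if_splits)
          then have "V \<subseteq> N (restrict y E)" using S by blast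
          then have "(restrict y E)(l := y l) \<in> A" using y by (auto simp: N_def PiE_iff)
          also have "(restrict y E)(l := y l) = y"
            using lE y by (intro extensionalityI[of _ "insert l E"]) (auto simp: PiE_iff extensional_def)
          finally show ?thesis .
        qed
        then have "has_box (insert l E) k A"
          unfolding has_box_def using S V lE by (intro exI[of _ "S(l := V)"]) (auto simp: Vs_def)
        then show False using A(2) by contradiction
      qed
    qed (auto simp: X_def)
    also have "\<dots> \<le> real n ^ k l * (C * real n powr (real (card E) - q))"
    proof (intro mult_right_mono)
      have "card Vs = n choose k l" unfolding Vs_def by (simp add: n_subsets)
      also have "\<dots> \<le> n ^ k l"
        by (cases "k l \<le> n") (auto intro: binomial_le_pow simp: binomial_eq_0)
      finally show "of_nat (card Vs) \<le> real n ^ k l" by (metis of_nat_le_iff of_nat_power)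
    qed (use C in simp)
    finally have binom: "real (\<Sum>x\<in>X. card (N x) choose k l)
      \<le> real n ^ k l * (C * real n powr (real (card E) - q))" .
    have "real (card A) \<le> (\<Sum>x\<in>X. real (card (N x)))"
      using cardA by (simp flip: of_nat_sum)
    also have "\<dots> \<le> (\<Sum>x\<in>X. k l * a + k l / a ^ (k l - 1) * real (card (N x) choose k l))"
      using le_threshold_plus_binomial[OF kl a] by (intro sum_mono) simp
    also have "\<dots> = real n ^ card E * (k l * a) + k l / a ^ (k l - 1) *
        real (\<Sum>x\<in>X. card (N x) choose k l)"
      by (simp add: sum.distrib sum_distrib_left cardX)
    also have "\<dots> \<le> real n ^ card E * (k l * a) + k l / a ^ (k l - 1) *
        (real n ^ k l * (C * real n powr (real (card E) - q)))"
      using a by (intro add_left_mono mult_left_mono binom) auto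
    also have "a ^ (k l - 1) = real n powr e"
      using n kl by (simp add: a_def e_def powr_realpow[symmetric] powr_powr of_nat_diff)
    also have "real n ^ card E * (k l * a) = k l * real n powr (real (card E) + 1 - q / k l)"
      using n by (simp add: a_def powr_realpow[symmetric] powr_add[symmetric] add_diff_eq)
    also have "k l / real n powr e *
        (real n ^ k l * (C * real n powr (real (card E) - q))) =
        k l * C * (real n powr k l * real n powr (real (card E) - q)
          * real n powr (- e))"
      using n by (simp add: powr_realpow powr_minus divide_inverse mult_ac)
    also have "real n powr k l * real n powr (real (card E) - q)
          * real n powr (- e)
        = real n powr (real (card E) + 1 - q / k l)"
      unfolding powr_add[symmetric] using kl by (simp add: e_def field_simps)
    finally show ?thesis by (simp add: algebra_simps)
  qed
  moreover have "real (card (insert l E)) = real (card E) + 1" using lE finE by simp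
  moreover have "1 / (\<Prod>l\<in>insert l D. real (k l)) = q / k l"
    using insert by (simp add: q_def field_simps)
  moreover have "insert m (insert l D) = insert l E" by (auto simp: E_def)
  moreover have "k l * (1 + C) > 0" using kl C by simp
  ultimately show ?case by (intro exI[of _ "k l * (1 + C)"]) simp
qed

section \<open>Blow-ups of permutation patterns\<close>

text \<open>This is \<open>P \<otimes> R\<close> for sets of points: box \<open>j\<close> replaces
  the \<open>j\<close>-th one of \<open>P\<close>. For the \<open>\<pi>\<close> of a permutation
  matrix distinct ones differ in every coordinate, so the boxes have to be ordered but not
  aligned.\<close>

definition has_blowup ::
  "nat set \<Rightarrow> nat \<Rightarrow> (nat \<Rightarrow> nat \<Rightarrow> nat) \<Rightarrow> (nat \<Rightarrow> nat) \<Rightarrow> (nat \<Rightarrow> nat) set \<Rightarrow> bool" where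
  "has_blowup D p \<pi> k A \<longleftrightarrow> (\<exists>S. (\<forall>j<p. (\<forall>l\<in>D. card (S j l) = k l) \<and> PiE D (S j) \<subseteq> A) \<and>
    (\<forall>l\<in>D. \<forall>i<p. \<forall>j<p. \<pi> l i < \<pi> l j \<longrightarrow> (\<forall>x\<in>S i l. \<forall>y\<in>S j l. x < y)))"

section \<open>Moving boxes and blow-ups from blocks to the whole array\<close>

lemma residue_box_less:
  assumes "PiE D R \<subseteq> residue s D ` F" "\<And>l. l \<in> D \<Longrightarrow> R l \<noteq> {}" "s > 0" "l \<in> D" "r \<in> R l"
  shows "r < s"
proof -
  have "residue s D ` F \<subseteq> PiE D (\<lambda>_. {..<s})" using assms(3) by (auto simp: residue_def)
  then have "PiE D R \<subseteq> PiE D (\<lambda>_. {..<s})" using assms(1) by (rule order_trans[rotated])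
  then show ?thesis using assms(2,4,5) unfolding subset_PiE PiE_eq_empty_iff by blast
qed

text \<open>Inside block \<open>b\<close> a point is determined by its residues, so translating by
  \<open>b l * s\<close> recovers actual points. Nonempty factors are what forces the values in
  \<open>R l\<close> below \<open>s\<close>.\<close>

lemma residue_box_shift:
  assumes R: "PiE D R \<subseteq> residue s D ` fibre s D A b" "\<And>l. l \<in> D \<Longrightarrow> R l \<noteq> {}"
    and s: "s > 0" and A: "A \<subseteq> extensional D" and b: "b \<in> extensional D"
  shows "PiE D (\<lambda>l. (+) (b l * s) ` R l) \<subseteq> A"
proof
  fix x assume x: "x \<in> PiE D (\<lambda>l. (+) (b l * s) ` R l)"
  have *: "x l div s = b l \<and> x l mod s \<in> R l" if l: "l \<in> D" for l
  proof -
    obtain r where r: "r \<in> R l" "x l = b l * s + r" using x l by (auto simp: PiE_iff)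
    then have "r < s" using residue_box_less[OF R s l] by simp
    then show ?thesis using r s by simp
  qed
  then have "residue s D x \<in> PiE D R" by (auto simp: residue_def)
  then obtain a where a: "a \<in> A" "block s D a = b" "residue s D x = residue s D a"
    using R(1) by auto
  have "block s D x = b"
    using * b by (intro extensionalityI[of _ D]) (auto simp: block_def)
  then have "block s D x = block s D a" using a by simp
  moreover have "x \<in> extensional D" "a \<in> extensional D" using x a A by (auto simp: PiE_def)
  ultimately have "x = a" using a block_residue_eqI[of x D a s] by simp
  then show "x \<in> A" using a by simp
qed

lemma has_blowup_fibre:
  assumes "has_blowup D p \<pi> k (residue s D ` fibre s D A b)" "b \<in> extensional D"
    and k: "\<And>l. l \<in> D \<Longrightarrow> k l > 0" and s: "s > 0" and A: "A \<subseteq> extensional D"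
  shows "has_blowup D p \<pi> k A"
proof -
  obtain S where "(\<forall>j<p. (\<forall>l\<in>D. card (S j l) = k l) \<and> PiE D (S j) \<subseteq> residue s D ` fibre s D A b) \<and>
    (\<forall>l\<in>D. \<forall>i<p. \<forall>j<p. \<pi> l i < \<pi> l j \<longrightarrow> (\<forall>x\<in>S i l. \<forall>y\<in>S j l. x < y))"
    using assms(1) unfolding has_blowup_def by (rule exE)
  note S_box = this[THEN conjunct1, rule_format] and S_less = this[THEN conjunct2, rule_format]
  note S = S_box[THEN conjunct1, rule_format] S_box[THEN conjunct2] S_less
  have ne: "S j l \<noteq> {}" if "j < p" "l \<in> D" for j l
    using S(1)[OF that] k[OF that(2)] by auto
  show ?thesis unfolding has_blowup_def
  proof (intro exI[of _ "\<lambda>j l. (+) (b l * s) ` S j l"] conjI allI impI ballI)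
    fix j assume j: "j < p"
    show "PiE D (\<lambda>l. (+) (b l * s) ` S j l) \<subseteq> A"
      using S(2) ne j s A assms(2) by (intro residue_box_shift) auto
  next
    fix l i j x y assume "l \<in> D" "i < p" "j < p" "\<pi> l i < \<pi> l j"
      "x \<in> (+) (b l * s) ` S i l" "y \<in> (+) (b l * s) ` S j l"
    then show "x < y" using S(3)[of l i j] by fastforce
  qed (simp add: S(1) card_image)
qed

text \<open>If one block index is smaller in coordinate \<open>l\<close>, everything inside that
  block is smaller there. Hence one arbitrary box per block of the pattern gives boxes in the right
  order.\<close>

lemma has_blowup_blocks:
  assumes "has_pattern D p \<pi> {b \<in> block s D ` A. has_box D k (residue s D ` fibre s D A b)}"
    and k: "\<And>l. l \<in> D \<Longrightarrow> k l > 0" and s: "s > 0" and A: "A \<subseteq> extensional D"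
  shows "has_blowup D p \<pi> k A"
proof -
  define B where "B = {b \<in> block s D ` A. has_box D k (residue s D ` fibre s D A b)}"
  obtain y where "(\<forall>j<p. y j \<in> B) \<and> (\<forall>l\<in>D. \<forall>i<p. \<forall>j<p. \<pi> l i < \<pi> l j \<longrightarrow> y i l < y j l)"
    using assms(1) unfolding has_pattern_def B_def by (rule exE)
  note yB = this[THEN conjunct1, rule_format] and y_less = this[THEN conjunct2, rule_format]
  have y: "y j \<in> block s D ` A" "has_box D k (residue s D ` fibre s D A (y j))" if "j < p" for j
    using yB[OF that] unfolding B_def by simp_all
  have y_ext: "y j \<in> extensional D" if "j < p" for j
    using y(1)[OF that] by (auto simp: block_def)
  have "\<forall>j\<in>{..<p}. \<exists>R. (\<forall>l\<in>D. card (R l) = k l) \<and> PiE D R \<subseteq> residue s D ` fibre s D A (y j)"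
    using y(2) unfolding has_box_def by simp
  from bchoice[OF this] obtain R where *: "\<forall>j\<in>{..<p}. (\<forall>l\<in>D. card (R j l) = k l) \<and>
    PiE D (R j) \<subseteq> residue s D ` fibre s D A (y j)" by (rule exE)
  then have R_card: "card (R j l) = k l" if "j < p" "l \<in> D" for j l using that by simp
  have R_box: "PiE D (R j) \<subseteq> residue s D ` fibre s D A (y j)" if "j < p" for j
    using * that by simp
  note R = R_card R_box
  have ne: "R j l \<noteq> {}" if "j < p" "l \<in> D" for j l
    using R(1)[OF that] k[OF that(2)] by auto
  show ?thesis unfolding has_blowup_def
  proof (intro exI[of _ "\<lambda>j l. (+) (y j l * s) ` R j l"] conjI allI impI ballI)
    fix j assume j: "j < p"
    show "PiE D (\<lambda>l. (+) (y j l * s) ` R j l) \<subseteq> A"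
      using R(2) ne j s A y_ext by (intro residue_box_shift) auto
  next
    fix l i j u v assume *: "l \<in> D" "i < p" "j < p" "\<pi> l i < \<pi> l j"
      and u: "u \<in> (+) (y i l * s) ` R i l" and v: "v \<in> (+) (y j l * s) ` R j l"
    obtain r where r: "r \<in> R i l" "u = y i l * s + r" using u by blast
    have "r < s" using residue_box_less[OF R(2) ne s] r * by blast
    then have "u < Suc (y i l) * s" using r by simp
    also have "\<dots> \<le> y j l * s" using y_less[OF *] by (intro mult_right_mono) auto
    also have "\<dots> \<le> v" using v by auto
    finally show "u < v" .
  qed (simp add: R(1) card_image)
qed

text \<open>Used with the roles opposite to the Marcus-Tardos recursion: the number of blocks per
  side stays fixed while the block side grows, so that the box bound \<open>h\<close> is applied at
  a large scale.\<close>

lemma blowup_recursion: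
  assumes D: "finite D" and k: "\<And>l. l \<in> D \<Longrightarrow> k l > 0" and s: "s > 0"
    and A: "A \<subseteq> PiE D (\<lambda>_. {..<s * N})" and avoids: "\<not> has_blowup D p \<pi> k A"
    and pattern: "\<And>B. \<lbrakk>B \<subseteq> PiE D (\<lambda>_. {..<N}); \<not> has_pattern D p \<pi> B\<rbrakk> \<Longrightarrow> real (card B) \<le> g"
    and box: "\<And>B. \<lbrakk>B \<subseteq> PiE D (\<lambda>_. {..<s}); \<not> has_box D k B\<rbrakk> \<Longrightarrow> real (card B) \<le> h"
    and blowup: "\<And>B. \<lbrakk>B \<subseteq> PiE D (\<lambda>_. {..<s}); \<not> has_blowup D p \<pi> k B\<rbrakk> \<Longrightarrow> real (card B) \<le> f"
    and "h \<ge> 0" "f \<ge> 0"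
  shows "real (card A) \<le> g * f + real N ^ card D * h"
proof -
  define X where "X = block s D ` A"
  define B where "B = {b \<in> X. has_box D k (residue s D ` fibre s D A b)}"
  have ext: "A \<subseteq> extensional D" using A by (auto simp: PiE_def)
  have finA: "finite A" by (rule finite_subset[OF A]) (simp add: finite_PiE D)
  have X: "X \<subseteq> PiE D (\<lambda>_. {..<N})" unfolding X_def by (rule block_in_cube[OF A])
  have finX: "finite X" using finA by (simp add: X_def)
  have X_ext: "X \<subseteq> extensional D" using X by (auto simp: PiE_def)
  have res: "residue s D ` F \<subseteq> PiE D (\<lambda>_. {..<s})" for F
    using s by (auto simp: residue_def)
  have fib: "card (fibre s D A b) = card (residue s D ` fibre s D A b)" for b
    by (intro card_image[symmetric] inj_on_residue_fibre ext)
  have "A = (\<Union>b\<in>X. fibre s D A b)" by (auto simp: X_def)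
  then have "card A = card (\<Union>b\<in>X. fibre s D A b)" by simp
  also have "\<dots> \<le> (\<Sum>b\<in>X. card (fibre s D A b))" by (rule card_UN_le[OF finX])
  finally have "real (card A) \<le> (\<Sum>b\<in>X. real (card (fibre s D A b)))"
    by (simp flip: of_nat_sum)
  also have "\<dots> = (\<Sum>b\<in>B. real (card (fibre s D A b))) + (\<Sum>b\<in>X - B. real (card (fibre s D A b)))"
    using finX by (subst sum.subset_diff[of B X]) (auto simp: B_def)
  also have "(\<Sum>b\<in>B. real (card (fibre s D A b))) \<le> of_nat (card B) * f"
  proof (intro sum_bounded_above)
    fix b assume "b \<in> B"
    then have "b \<in> extensional D" using X_ext by (auto simp: B_def)
    then have "\<not> has_blowup D p \<pi> k (residue s D ` fibre s D A b)"
      using avoids has_blowup_fibre k s ext by blast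
    then show "real (card (fibre s D A b)) \<le> f" unfolding fib by (intro blowup res)
  qed
  also have "of_nat (card B) * f \<le> g * f"
  proof (intro mult_right_mono pattern)
    show "\<not> has_pattern D p \<pi> B"
      using avoids has_blowup_blocks[of D p \<pi> s A k] k s ext by (auto simp: B_def X_def)
  qed (use X \<open>f \<ge> 0\<close> in \<open>auto simp: B_def\<close>)
  also have "(\<Sum>b\<in>X - B. real (card (fibre s D A b))) \<le> of_nat (card (X - B)) * h"
  proof (intro sum_bounded_above)
    fix b assume "b \<in> X - B"
    then show "real (card (fibre s D A b)) \<le> h" unfolding fib by (intro box res) (auto simp: B_def)
  qed
  also have "\<dots> \<le> real N ^ card D * h"
  proof (intro mult_right_mono)
    have "card (X - B) \<le> card (PiE D (\<lambda>_. {..<N}))"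
      using X D by (intro card_mono finite_PiE) auto
    then show "of_nat (card (X - B)) \<le> real N ^ card D"
      using D by (simp add: card_PiE flip: of_nat_power)
  qed (use \<open>h \<ge> 0\<close> in simp)
  finally show ?thesis by simp
qed

theorem blowup_upper_bound:
  fixes a :: real
  assumes D: "finite D" and \<pi>: "\<And>l j. \<lbrakk>l \<in> D; j < p\<rbrakk> \<Longrightarrow> \<pi> l j < p" and p: "p > 0"
    and k: "\<And>l. l \<in> D \<Longrightarrow> k l > 0" and m: "m \<in> D" and "l \<in> D" "l \<noteq> m" "k l > 1"
  defines "a \<equiv> 1 / (\<Prod>i\<in>D - {m}. real (k i))"
  shows "\<exists>C::real. C > 0 \<and> (\<forall>n>0. \<forall>A. A \<subseteq> PiE D (\<lambda>_. {..<n}) \<longrightarrow> \<not> has_blowup D p \<pi> k A \<longrightarrow>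
    card A \<le> C * real n powr (card D - a))"
proof -
  \<comment> \<open>Coordinate \<open>l\<close> survives the removal of \<open>m\<close>; this keeps
    \<open>a\<close> at most 1/2.\<close>
  have "(\<Prod>i\<in>D - {m}. real (k i)) \<ge> 2"
  proof -
    have "(\<Prod>i\<in>D - {m}. real (k i)) = k l * (\<Prod>i\<in>D - {m} - {l}. real (k i))"
      using assms by (intro prod.remove) auto
    moreover have "(\<Prod>i\<in>D - {m} - {l}. real (k i)) \<ge> 1"
      using k by (intro prod_ge_1) (simp add: Suc_le_eq)
    ultimately show ?thesis using \<open>k l > 1\<close> mult_mono[of 2 "real (k l)" 1] by force
  qed
  then have a: "0 < a" "a \<le> 1 / 2" unfolding a_def by (auto intro: frac_le)
  have "card D \<ge> 1" using D m by (auto simp: Suc_le_eq card_gt_0_iff)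
  then have D1: "real (card D) = real (card D - 1) + 1" by simp
  define r where "r = card D - a"
  have r: "r \<ge> 0" using a \<open>card D \<ge> 1\<close> by (simp add: r_def)
  obtain c where "\<forall>t. \<forall>A. A \<subseteq> PiE D (\<lambda>_. {..<((p + 1)\<^sup>2) ^ t}) \<longrightarrow> \<not> has_pattern D p \<pi> A \<longrightarrow>
      card A \<le> c * (((p + 1)\<^sup>2) ^ t) ^ (card D - 1)"
    using klazar_marcus[of D p \<pi>] D m \<pi> by (metis empty_iff)
  note c = this[rule_format]
  have kD: "\<And>i. i \<in> insert m (D - {m}) \<Longrightarrow> k i > 0" using k m by auto
  obtain H where *: "H > 0 \<and> (\<forall>n>0. \<forall>A. A \<subseteq> PiE D (\<lambda>_. {..<n}) \<longrightarrow> \<not> has_box D k A \<longrightarrow>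
      card A \<le> H * real n powr r)"
    using erdos_box[of "D - {m}" m k, OF _ _ kD] D unfolding a_def r_def insert_Diff[OF m]
    by (elim meta_impE exE) simp_all
  note H = *[THEN conjunct1] *[THEN conjunct2, rule_format]
  \<comment> \<open>A power of \<open>(p + 1)^2\<close>, as the bound for permutation patterns
    requires, and so large that its square root \<open>u\<close> exceeds \<open>2 * c\<close>. Since
    \<open>a\<close> is at most 1/2, \<open>T powr (1 - a)\<close> is then at least
    \<open>2 * c\<close>.\<close>
  define T where "T = ((p + 1)\<^sup>2) ^ (2 * c + 1)"
  define u where "u = (p + 1) ^ (2 * c + 1)"
  have T: "T = u\<^sup>2" unfolding T_def u_def by (simp only: power_mult[symmetric] mult.commute)
  have "2 * c + 1 < 2 ^ (2 * c + 1)" by (rule less_exp)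
  also have "\<dots> \<le> u" unfolding u_def using p by (intro power_mono) auto
  finally have u: "2 * c + 1 < u" .
  have T2: "T \<ge> 2" using u power_increasing[of 1 2 u] by (simp add: T)
  have "real (2 * c) \<le> real u" using u by simp
  also have "real u = real T powr (1 / 2)" by (simp add: T powr_half_sqrt)
  also have "\<dots> \<le> real T powr (1 - a)" using a T2 by (intro powr_mono) auto
  finally have Tc: "2 * real c \<le> real T powr (1 - a)" by simp
  have "real T powr r = real T ^ (card D - 1) * real T powr (1 - a)"
    using T2 by (simp add: r_def D1 powr_add[symmetric] powr_realpow[symmetric] add_diff_eq)
  then have Tr: "2 * (c * real T ^ (card D - 1)) \<le> real T powr r"
    using mult_left_mono[OF Tc, of "real T ^ (card D - 1)"] by (simp add: mult_ac)
  \<comment> \<open>The 1 settles the cube of side 1; the rest lets the blocks without a box use at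
    most half of \<open>C * T powr r\<close>.\<close>
  define C where "C = 1 + 2 * (real T ^ card D * H)"
  have C: "C \<ge> 1" using H by (simp add: C_def)
  have powers: "card A \<le> C * real (T ^ t) powr r"
    if "A \<subseteq> PiE D (\<lambda>_. {..<T ^ t})" "\<not> has_blowup D p \<pi> k A" for A t
    using that
  proof (induction t arbitrary: A)
    case 0
    have "card A \<le> card (PiE D (\<lambda>_. {..<(1::nat)}))"
      using 0 D by (intro card_mono finite_PiE) auto
    then show ?case using C D by (simp add: card_PiE)
  next
    case (Suc t)
    let ?s = "T ^ t"
    have s: "?s > 0" using T2 by simp
    have "real (card A) \<le> real (c * T ^ (card D - 1)) * (C * real ?s powr r)
        + real T ^ card D * (H * real ?s powr r)"
    proof (intro blowup_recursion[where s = ?s and k = k and D = D and p = p and \<pi> = \<pi>] D k s)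
      fix B assume "B \<subseteq> PiE D (\<lambda>_. {..<T})" "\<not> has_pattern D p \<pi> B"
      then show "real (card B) \<le> real (c * T ^ (card D - 1))"
        using c unfolding T_def of_nat_le_iff by blast
    next
      fix B assume "B \<subseteq> PiE D (\<lambda>_. {..<?s})" "\<not> has_box D k B"
      then show "real (card B) \<le> H * real ?s powr r" using H(2) s by blast
    qed (use Suc H(1) C in \<open>auto simp: mult.commute\<close>)
    \<comment> \<open>Written as an average: each of the two kinds of blocks may use half of the
      target.\<close>
    also have "\<dots> = (C * (2 * (c * real T ^ (card D - 1))) + 2 * (real T ^ card D * H)) / 2
        * real ?s powr r" by (simp add: field_simps)
    also have "\<dots> \<le> (C * real T powr r + C * real T powr r) / 2 * real ?s powr r"
    proof (intro mult_right_mono divide_right_mono add_mono mult_left_mono Tr)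
      have "1 \<le> real T powr r" using T2 r by (intro ge_one_powr_ge_zero) auto
      then have "C * 1 \<le> C * real T powr r" using C by (intro mult_left_mono) auto
      then show "2 * (real T ^ card D * H) \<le> C * real T powr r" by (simp add: C_def)
    qed (use C in auto)
    also have "\<dots> = C * real (T ^ Suc t) powr r" by (simp add: powr_mult)
    finally show ?case .
  qed
  have "card A \<le> C * real T powr r * real n powr r"
    if n: "n > 0" and A: "A \<subseteq> PiE D (\<lambda>_. {..<n})" "\<not> has_blowup D p \<pi> k A" for A n
  proof -
    \<comment> \<open>Rounding the side up to a power of \<open>T\<close> costs at most the factor
      \<open>T powr r\<close>.\<close>
    obtain t where t: "T ^ t \<le> n" "n < T ^ (t + 1)"
      using ex_power_ivl1[of T n] T2 n by auto
    have "A \<subseteq> PiE D (\<lambda>_. {..<T ^ (t + 1)})"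
      using A(1) t(2) by (rule_tac order_trans[OF _ PiE_mono]) auto
    from powers[OF this A(2)] have "card A \<le> C * real (T ^ (t + 1)) powr r" .
    also have "\<dots> \<le> C * real (T * n) powr r"
    proof (intro mult_left_mono powr_mono2)
      show "real (T ^ (t + 1)) \<le> real (T * n)" unfolding of_nat_le_iff using t(1) by simp
    qed (use r C in auto)
    finally show ?thesis by (simp add: powr_mult mult.assoc)
  qed
  moreover have "C * real T powr r > 0" using C T2 by simp
  ultimately show ?thesis
    unfolding r_def[symmetric] by (intro exI[of _ "C * real T powr r"]) simp
qed

section \<open>The deletion method\<close>

text \<open>
  The probabilistic choice of a subset of \<open>V\<close> with density \<open>q\<close>, derandomized by deciding the
  elements one by one with conditional expectations.
\<close>

lemma weighted_subset_choice:
  fixes q :: real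
  assumes "finite V" "finite F" "0 \<le> q" "q \<le> 1"
  shows "\<exists>A\<subseteq>V. q * card V - (\<Sum>e\<in>F. q ^ card (e \<inter> V)) \<le> real (card A) - real (card {e \<in> F. e \<inter> V \<subseteq> A})"
  using assms
proof (induction V arbitrary: F rule: finite_induct)
  case empty
  then show ?case by simp
next
  case (insert x V)
  \<comment> \<open>Elements outside \<open>V\<close> count as already accepted, hence the sets
    \<open>e \<inter> V\<close>. Accepting \<open>x\<close> keeps all of \<open>F\<close> alive,
    rejecting it leaves only \<open>G\<close>.\<close>
  define G where "G = {e \<in> F. x \<notin> e}"
  have finG: "finite G" and GF: "G \<subseteq> F" using insert by (auto simp: G_def)
  obtain A where A: "A \<subseteq> V" and A_le: "q * card V - (\<Sum>e\<in>F. q ^ card (e \<inter> V))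
      \<le> real (card A) - real (card {e \<in> F. e \<inter> V \<subseteq> A})"
    using insert.IH[OF insert.prems(1-3)] by auto
  obtain B where B: "B \<subseteq> V" and B_le: "q * card V - (\<Sum>e\<in>G. q ^ card (e \<inter> V))
      \<le> real (card B) - real (card {e \<in> G. e \<inter> V \<subseteq> B})"
    using insert.IH[OF finG insert.prems(2-3)] by auto
  define t where "t = q * card (insert x V) - (\<Sum>e\<in>F. q ^ card (e \<inter> insert x V))"
  define u where "u = real (card (insert x A)) - real (card {e \<in> F. e \<inter> insert x V \<subseteq> insert x A})"
  define v where "v = real (card B) - real (card {e \<in> F. e \<inter> insert x V \<subseteq> B})"
  have "{e \<in> F. e \<inter> insert x V \<subseteq> insert x A} = {e \<in> F. e \<inter> V \<subseteq> A}"
    using insert.hyps by auto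
  moreover have "card (insert x A) = card A + 1"
    using A insert.hyps by (subst card_insert_disjoint) (auto intro: finite_subset)
  ultimately have u: "1 + (q * card V - (\<Sum>e\<in>F. q ^ card (e \<inter> V))) \<le> u"
    using A_le by (simp add: u_def)
  have "{e \<in> F. e \<inter> insert x V \<subseteq> B} = {e \<in> G. e \<inter> V \<subseteq> B}"
    using B insert.hyps by (auto simp: G_def)
  then have v: "q * card V - (\<Sum>e\<in>G. q ^ card (e \<inter> V)) \<le> v" using B_le by (simp add: v_def)
  have split: "(\<Sum>e\<in>F. h e) = (\<Sum>e\<in>G. h e) + (\<Sum>e\<in>F - G. h e)" for h :: "_ \<Rightarrow> real"
    using sum.subset_diff[OF GF insert.prems(1)] by (simp add: add.commute)
  have "(\<Sum>e\<in>F. q ^ card (e \<inter> insert x V)) = (\<Sum>e\<in>G. q ^ card (e \<inter> V)) + q * (\<Sum>e\<in>F - G. q ^ card (e \<inter> V))"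
    unfolding split sum_distrib_left
    using insert.hyps by (intro arg_cong2[of _ _ _ _ "(+)"] sum.cong) (auto simp: G_def)
  \<comment> \<open>The expectation before deciding on \<open>x\<close> is the average, with weights
    \<open>q\<close> and \<open>1 - q\<close>, of those after accepting and after rejecting; so one
    decision does not decrease it.\<close>
  then have "t = q * (1 + (q * card V - (\<Sum>e\<in>F. q ^ card (e \<inter> V))))
      + (1 - q) * (q * card V - (\<Sum>e\<in>G. q ^ card (e \<inter> V)))"
    using insert.hyps by (simp add: t_def split algebra_simps)
  also have "\<dots> \<le> q * u + (1 - q) * v"
    using u v insert.prems by (intro add_mono mult_left_mono) auto
  finally have "t \<le> u \<or> t \<le> v"
    using convex_bound_lt[of u t v q "1 - q"] insert.prems by fastforce
  then show ?case
  proof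
    assume "t \<le> u"
    then show ?thesis using A unfolding t_def u_def by (intro exI[of _ "insert x A"]) auto
  next
    assume "t \<le> v"
    then show ?thesis using B unfolding t_def v_def by (intro exI[of _ B]) auto
  qed
qed

lemma deletion_method:
  fixes q :: real
  assumes V: "finite V" and F: "finite F" and "0 \<le> q" "q \<le> 1" and "r > 0"
    and e: "\<And>e. e \<in> F \<Longrightarrow> e \<subseteq> V \<and> card e = r"
  shows "\<exists>A\<subseteq>V. (\<forall>e\<in>F. \<not> e \<subseteq> A) \<and> q * card V - card F * q ^ r \<le> card A"
proof -
  obtain A where A: "A \<subseteq> V" and le: "q * card V - (\<Sum>e\<in>F. q ^ card (e \<inter> V))
      \<le> real (card A) - real (card {e \<in> F. e \<inter> V \<subseteq> A})"
    using weighted_subset_choice[OF assms(1-4)] by auto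
  define G where "G = {e \<in> F. e \<subseteq> A}"
  have "{e \<in> F. e \<inter> V \<subseteq> A} = G" using e unfolding G_def by (metis inf.absorb1)
  moreover have "(\<Sum>e\<in>F. q ^ card (e \<inter> V)) = (\<Sum>e\<in>F. q ^ r)"
    using e by (intro sum.cong) (auto simp: Int_absorb2)
  ultimately have le: "q * card V - card F * q ^ r \<le> real (card A) - real (card G)"
    using le by simp
  have "\<forall>e\<in>F. \<exists>x. x \<in> e"
    using e \<open>r > 0\<close> by (metis all_not_in_conv card.empty less_irrefl)
  from bchoice[OF this] obtain c where c: "\<forall>e\<in>F. c e \<in> e" by blast
  have finG: "finite G" using F by (simp add: G_def)
  have "card A - card (c ` G) \<le> card (A - c ` G)" using finG by (intro diff_card_le_card_Diff) simp
  moreover have "card (c ` G) \<le> card G" using finG by (rule card_image_le)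
  ultimately have "real (card A) - real (card G) \<le> card (A - c ` G)" by linarith
  moreover have "\<not> e \<subseteq> A - c ` G" if "e \<in> F" for e
  proof
    assume "e \<subseteq> A - c ` G"
    moreover have "c e \<in> e" using c that by blast
    ultimately have "c e \<notin> c ` G" "e \<in> G" using that by (auto simp: G_def)
    then show False by blast
  qed
  ultimately show ?thesis using A le by (intro exI[of _ "A - c ` G"]) auto
qed

lemma box_lower_bound:
  fixes b :: real
  assumes D: "finite D" and k: "\<And>l. l \<in> D \<Longrightarrow> k l > 0" and K: "(\<Prod>l\<in>D. k l) \<ge> 2" and n: "n > 0"
  defines "b \<equiv> ((\<Sum>l\<in>D. real (k l)) - card D) / ((\<Prod>l\<in>D. real (k l)) - 1)"
  shows "\<exists>A. A \<subseteq> PiE D (\<lambda>_. {..<n}) \<and> \<not> has_box D k A \<and> 1 / 4 * real n powr (card D - b) \<le> card A"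
proof -
  define K where "K = (\<Prod>l\<in>D. k l)"
  define s where "s = (\<Sum>l\<in>D. k l)"
  define V where "V = PiE D (\<lambda>_. {..<n})"
  define F where "F = PiE D ` PiE D (\<lambda>l. {S. S \<subseteq> {..<n} \<and> card S = k l})"
  \<comment> \<open>The choice \<open>n powr (- b)\<close> solves
    \<open>n ^ s * q ^ K = q * n ^ card D\<close>. The factor 1/2 then shrinks the loss by
    \<open>(1 / 2) ^ (K - 1)\<close>, so at least half of the expected ones remain.\<close>
  define q where "q = 1 / 2 * real n powr (- b)"
  have K2: "K \<ge> 2" using assms by (simp add: K_def)
  have b_eq: "b = (real s - card D) / (real K - 1)" by (simp add: b_def K_def s_def)
  have "card D \<le> s" unfolding s_def using sum_mono[of D "\<lambda>_. 1" k] k by (simp add: Suc_le_eq)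
  then have "b \<ge> 0" using K2 by (simp add: b_eq)
  then have "real n powr (- b) \<le> 1" using n powr_mono[of "- b" 0 "real n"] by simp
  then have q: "0 \<le> q" "q \<le> 1" by (auto simp: q_def)
  have cardV: "card V = n ^ card D" using D by (simp add: V_def card_PiE)
  have "card F \<le> card (PiE D (\<lambda>l. {S. S \<subseteq> {..<n} \<and> card S = k l}))"
    unfolding F_def using D by (intro card_image_le finite_PiE) auto
  also have "\<dots> = (\<Prod>l\<in>D. n choose k l)" using D by (simp add: card_PiE n_subsets)
  also have "\<dots> \<le> (\<Prod>l\<in>D. n ^ k l)"
    by (intro prod_mono) (metis binomial_eq_0 binomial_le_pow leI zero_le)
  also have "\<dots> = n ^ s" by (simp add: s_def power_sum)
  finally have cardF: "card F \<le> n ^ s" .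
  have "\<exists>A\<subseteq>V. (\<forall>e\<in>F. \<not> e \<subseteq> A) \<and> q * card V - card F * q ^ K \<le> card A"
  proof (rule deletion_method)
    show "finite V" using D by (simp add: V_def finite_PiE)
    show "finite F" using D unfolding F_def by (intro finite_imageI finite_PiE) auto
    fix e assume "e \<in> F"
    then obtain S where S: "e = PiE D S" "\<And>l. l \<in> D \<Longrightarrow> S l \<subseteq> {..<n} \<and> card (S l) = k l"
      by (auto simp: F_def PiE_iff)
    then show "e \<subseteq> V \<and> card e = K" using D by (auto simp: V_def K_def card_PiE intro: PiE_mono)
  qed (use q K2 in auto)
  then obtain A where A: "A \<subseteq> V" "\<And>e. e \<in> F \<Longrightarrow> \<not> e \<subseteq> A" "q * card V - card F * q ^ K \<le> card A"
    by blast
  have "q ^ (K - 1) = (1 / 2) ^ (K - 1) * real n powr (- b * (real K - 1))"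
    using n K2 by (simp add: q_def power_divide powr_realpow[symmetric] powr_powr of_nat_diff)
  also have "- b * (real K - 1) = real (card D) - real s" using K2 by (simp add: b_eq)
  finally have qK: "q ^ K = q * ((1 / 2) ^ (K - 1) * real n powr (real (card D) - real s))"
    using K2 by (cases K) auto
  have "real (card F) * q ^ K \<le> real n ^ s * q ^ K"
    using q cardF by (intro mult_right_mono) (auto simp flip: of_nat_power)
  also have "\<dots> = (1 / 2) ^ (K - 1) * (q * real n ^ card D)"
    unfolding qK using n by (simp add: powr_diff powr_realpow)
  also have "\<dots> \<le> (1 / 2) ^ 1 * (q * real n ^ card D)"
    using q K2 by (intro mult_right_mono power_decreasing) auto
  finally have "1 / 2 * (q * real n ^ card D) \<le> card A" using A(3) by (simp add: cardV)
  also have "1 / 2 * (q * real n ^ card D) = 1 / 4 * real n powr (card D - b)"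
    using n by (simp add: q_def powr_diff powr_minus powr_realpow field_simps)
  finally have le: "1 / 4 * real n powr (card D - b) \<le> card A" .
  have "\<not> has_box D k A"
  proof
    assume "has_box D k A"
    then obtain S where S: "\<forall>l\<in>D. card (S l) = k l" "PiE D S \<subseteq> A" unfolding has_box_def by blast
    then have "PiE D S \<subseteq> PiE D (\<lambda>_. {..<n})" using A(1) by (auto simp: V_def)
    moreover have "PiE D S \<noteq> {}" using S(1) k by (force simp: PiE_eq_empty_iff)
    ultimately have "\<forall>l\<in>D. S l \<subseteq> {..<n}" by (simp add: subset_PiE)
    \<comment> \<open>\<open>F\<close> is indexed by extensional families, and restricting
      \<open>S\<close> does not change its product.\<close>
    then have "PiE D (restrict S D) \<in> F" using S(1) unfolding F_def
      by (intro imageI restrict_PiE_iff[THEN iffD2]) blast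
    moreover have "PiE D (restrict S D) = PiE D S" by (intro PiE_cong) simp
    ultimately show False using A(2) S(2) by auto
  qed
  then show ?thesis using A(1) le unfolding V_def by blast
qed

section \<open>Matrices\<close>

text \<open>An element of a finite set is identified by the number of smaller elements: there are
  \<open>j\<close> below \<open>g j\<close> and \<open>i\<close> below
  \<open>enumerate S i\<close>.\<close>

lemma enumerate_image_strict_mono:
  fixes g :: "nat \<Rightarrow> nat"
  assumes g: "strict_mono_on {..<N} g" and "i < N"
  shows "enumerate (g ` {..<N}) i = g i"
proof -
  define S where "S = g ` {..<N}"
  have inj: "inj_on g {..<N}" by (rule strict_mono_on_imp_inj_on[OF g])
  have fin: "finite S" and card: "card S = N" using inj by (auto simp: S_def card_image)
  have less: "g u < g v \<longleftrightarrow> u < v" if "u < N" "v < N" for u v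
    using strict_mono_on_less[OF g] that by simp
  obtain j where j: "j < N" "enumerate S i = g j"
    using finite_enumerate_in_set[OF fin] \<open>i < N\<close> card by (auto simp: S_def)
  have "{x \<in> S. x < g j} = g ` {..<j}" using j(1) less by (auto simp: S_def)
  then have "card {x \<in> S. x < g j} = j"
    using j(1) inj by (simp add: card_image inj_on_subset)
  moreover have "{x \<in> S. x < enumerate S i} = enumerate S ` {..<i}"
  proof (intro equalityI subsetI)
    fix x assume x: "x \<in> {x \<in> S. x < enumerate S i}"
    then obtain m where "m < card S" "enumerate S m = x" using finite_enumerate_Ex[OF fin] by auto
    then show "x \<in> enumerate S ` {..<i}" using x fin card \<open>i < N\<close> by auto
  qed (use fin card \<open>i < N\<close> in \<open>auto intro: finite_enumerate_in_set finite_enumerate_mono\<close>)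
  moreover have "inj_on (enumerate S) {..<i}"
    using finite_bij_enumerate[OF fin] card \<open>i < N\<close> by (auto simp: bij_betw_def intro: inj_on_subset)
  ultimately have "i = j" using j(2) by (simp add: card_image)
  then show ?thesis using j(2) by (simp add: S_def)
qed

text \<open>Coordinate 0 numbers the ones. Uniqueness within cross sections makes every other
  coordinate an injective, hence bijective, function of that number; \<open>x j l\<close> later
  serves as \<open>\<pi> l j\<close>.\<close>

lemma permutation_matrix_ones:
  assumes "permutation_matrix d p P" "d > 0"
  shows "\<exists>x. (\<forall>j<p. x j \<in> index_set d (\<lambda>_. p)) \<and>
    {i \<in> index_set d (\<lambda>_. p). P i = 1} = x ` {..<p} \<and>
    (\<forall>l<d. bij_betw (\<lambda>j. x j l) {..<p} {..<p})"
proof -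
  have ex1: "\<exists>!i. i \<in> index_set d (\<lambda>_. p) \<and> i l = c \<and> P i \<noteq> 0" if "l < d" "c < p" for l c
    using assms(1) that unfolding permutation_matrix_def cross_section_def by (simp add: conj_assoc)
  have P01: "P i = 1 \<longleftrightarrow> P i \<noteq> 0" if "i \<in> index_set d (\<lambda>_. p)" for i
  proof -
    have "P \<in> index_set d (\<lambda>_. p) \<rightarrow>\<^sub>E {0, 1}"
      using assms(1) unfolding permutation_matrix_def zero_one_matrix_def by (rule conjunct1)
    then have "P i \<in> {0, 1}" using that by (rule PiE_mem)
    then show ?thesis by auto
  qed
  define x where "x j = (THE i. i \<in> index_set d (\<lambda>_. p) \<and> i 0 = j \<and> P i \<noteq> 0)" for j
  have x: "x j \<in> index_set d (\<lambda>_. p)" "x j 0 = j" "P (x j) \<noteq> 0" if "j < p" for j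
    using theI'[OF ex1[OF assms(2) that]] unfolding x_def by auto
  have lt: "i l < p" if "i \<in> index_set d (\<lambda>_. p)" "l < d" for i l
    using that by (auto simp: index_set_def PiE_iff)
  show ?thesis
  proof (intro exI[of _ x] conjI allI impI)
    show "{i \<in> index_set d (\<lambda>_. p). P i = 1} = x ` {..<p}"
    proof (intro equalityI subsetI)
      fix i assume i: "i \<in> {i \<in> index_set d (\<lambda>_. p). P i = 1}"
      then have "i 0 < p" using lt assms(2) by auto
      then have "i = x (i 0)" using ex1[OF assms(2) \<open>i 0 < p\<close>] x[OF \<open>i 0 < p\<close>] i by auto
      then show "i \<in> x ` {..<p}" using \<open>i 0 < p\<close> by blast
    next
      fix i assume "i \<in> x ` {..<p}"
      then show "i \<in> {i \<in> index_set d (\<lambda>_. p). P i = 1}" using x P01 by auto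
    qed
    fix l assume l: "l < d"
    have "inj_on (\<lambda>j. x j l) {..<p}"
    proof (rule inj_onI)
      fix i j assume *: "i \<in> {..<p}" "j \<in> {..<p}" "x i l = x j l"
      then have "x i = x j" using ex1[OF l, of "x i l"] x[of i] x[of j] lt[OF _ l] by auto
      then show "i = j" using x(2) * by (metis lessThan_iff)
    qed
    then show "bij_betw (\<lambda>j. x j l) {..<p} {..<p}"
      using x(1) lt[OF _ l] by (intro bij_betw_imageI endo_inj_surj) auto
  qed (use x in auto)
qed

text \<open>In direction \<open>l\<close> the sets \<open>S j l\<close> are stacked by the
  \<open>l\<close>-th coordinates of the ones, in general a different order for each direction. As
  all have size \<open>k l\<close>, position \<open>i\<close> falls into block
  \<open>i div k l\<close>, as in the Kronecker product.\<close>

lemma contains_kronecker_if_blowup: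
  assumes A: "zero_one_matrix d (\<lambda>_. n) A"
    and x: "\<And>j. j < p \<Longrightarrow> x j \<in> index_set d (\<lambda>_. p)"
      "{i \<in> index_set d (\<lambda>_. p). P i = 1} = x ` {..<p}"
      "\<And>l. l < d \<Longrightarrow> bij_betw (\<lambda>j. x j l) {..<p} {..<p}"
    and k: "\<And>l. l < d \<Longrightarrow> k l > 0"
    and blowup: "has_blowup {..<d} p (\<lambda>l j. x j l) k {i \<in> index_set d (\<lambda>_. n). A i = 1}"
  shows "contains_matrix d (\<lambda>_. n) A (\<lambda>l. p * k l)
    (kronecker_product d (\<lambda>_. p) P k (all_ones_matrix d k))"
proof -
  define X where "X = {i \<in> index_set d (\<lambda>_. n). A i = 1}"
  obtain S where "(\<forall>j<p. (\<forall>l\<in>{..<d}. card (S j l) = k l) \<and> PiE {..<d} (S j) \<subseteq> X) \<and>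
    (\<forall>l\<in>{..<d}. \<forall>i<p. \<forall>j<p. x i l < x j l \<longrightarrow> (\<forall>u\<in>S i l. \<forall>v\<in>S j l. u < v))"
    using blowup unfolding has_blowup_def X_def by (rule exE)
  note S = this[THEN conjunct1, rule_format] and S_less = this[THEN conjunct2, rule_format]
  have S_card: "card (S j l) = k l" if "j < p" "l < d" for j l using S[OF that(1)] that(2) by simp
  have S_box: "PiE {..<d} (S j) \<subseteq> X" if "j < p" for j using S[OF that] by simp
  have S_fin: "finite (S j l)" "S j l \<noteq> {}" if "j < p" "l < d" for j l
    using S_card[OF that] k[OF that(2)] by (auto intro: card_ge_0_finite)
  have S_sub: "S j l \<subseteq> {..<n}" if "j < p" "l < d" for j l
  proof -
    have "PiE {..<d} (S j) \<subseteq> PiE {..<d} (\<lambda>_. {..<n})"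
      using S_box[OF that(1)] by (auto simp: X_def index_set_def)
    then show ?thesis using S_fin(2) that by (auto simp: subset_PiE PiE_eq_empty_iff)
  qed
  \<comment> \<open>\<open>\<sigma> l c\<close> is the number of the one of \<open>P\<close> whose
    coordinate \<open>l\<close> is \<open>c\<close>.\<close>
  define \<sigma> where "\<sigma> l = inv_into {..<p} (\<lambda>j. x j l)" for l
  have \<sigma>: "\<sigma> l c < p \<and> x (\<sigma> l c) l = c" if "l < d" "c < p" for l c
  proof -
    have "c \<in> (\<lambda>j. x j l) ` {..<p}" using x(3)[OF that(1)] that(2) by (simp add: bij_betw_def)
    then show ?thesis unfolding \<sigma>_def using inv_into_into f_inv_into_f by (metis (no_types, lifting) lessThan_iff)
  qed
  have \<sigma>_x: "\<sigma> l (x j l) = j" if "l < d" "j < p" for l j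
    unfolding \<sigma>_def using inv_into_f_f[OF bij_betw_imp_inj_on[OF x(3)[OF that(1)]], of j] that(2) by simp
  define g where "g l i = enumerate (S (\<sigma> l (i div k l)) l) (i mod k l)" for l i
  define U where "U l = g l ` {..<p * k l}" for l
  have g_in: "g l i \<in> S (\<sigma> l (i div k l)) l \<and> i div k l < p" if "l < d" "i < p * k l" for l i
  proof -
    have "i div k l < p" using that k by (simp add: less_mult_imp_div_less)
    then show ?thesis
      using that \<sigma> S_card S_fin k unfolding g_def by (auto intro!: finite_enumerate_in_set)
  qed
  have g_mono: "strict_mono_on {..<p * k l} (g l)" if l: "l < d" for l
  proof (rule strict_mono_onI)
    fix i j assume "i \<in> {..<p * k l}" "j \<in> {..<p * k l}" and "i < j"
    then have i: "i < p * k l" and j: "j < p * k l" by auto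
    note gi = g_in[OF l i] and gj = g_in[OF l j]
    show "g l i < g l j"
    proof (cases "i div k l = j div k l")
      case True
      then have "i mod k l < j mod k l"
        using \<open>i < j\<close> by (metis div_mult_mod_eq nat_add_left_cancel_less)
      then show ?thesis
        unfolding g_def True using gj \<sigma>[OF l] S_card S_fin k l
        by (intro finite_enumerate_mono) auto
    next
      case False
      then have "i div k l < j div k l" using \<open>i < j\<close> by (meson div_le_mono le_neq_implies_less less_imp_le)
      then show ?thesis
        using gi gj \<sigma>[OF l, of "i div k l"] \<sigma>[OF l, of "j div k l"] l
          S_less[of l "\<sigma> l (i div k l)" "\<sigma> l (j div k l)" "g l i" "g l j"] by simp
    qed
  qed
  have U_card: "card (U l) = p * k l" if "l < d" for l
    using strict_mono_on_imp_inj_on[OF g_mono[OF that]] by (simp add: U_def card_image)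
  have g_lt: "g l i < n" if "l < d" "i < p * k l" for l i
    using g_in[OF that] S_sub[OF conjunct1[OF \<sigma>] that(1), of l "i div k l"] that(1) by auto
  have U_sub: "U l \<subseteq> {..<n}" if "l < d" for l
    using g_lt[OF that] unfolding U_def by auto
  have shape: "index_set d (\<lambda>l. card (U l)) = index_set d (\<lambda>l. p * k l)"
    unfolding index_set_def using U_card by (intro PiE_cong) auto
  have "ones_to_zeros d (\<lambda>l. p * k l) (submatrix d U A)
    (kronecker_product d (\<lambda>_. p) P k (all_ones_matrix d k))"
    unfolding ones_to_zeros_def
  proof
    fix i assume i: "i \<in> index_set d (\<lambda>l. p * k l)"
    then have il: "i l < p * k l" if "l < d" for l using that by (auto simp: index_set_def PiE_iff)
    define y where "y = (\<lambda>l\<in>{..<d}. enumerate (U l) (i l))"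
    have y: "y = (\<lambda>l\<in>{..<d}. g l (i l))"
      unfolding y_def U_def using enumerate_image_strict_mono g_mono il by (intro restrict_ext) auto
    define b where "b = (\<lambda>l\<in>{..<d}. i l div k l)"
    have sub: "submatrix d U A i = A y" using i by (simp add: submatrix_def shape y_def)
    have "y \<in> index_set d (\<lambda>_. n)"
      using g_lt[OF _ il] by (simp add: y index_set_def)
    \<comment> \<open>At a zero of the product the entry of \<open>A\<close> is arbitrary, but it
      still has to be 0 or 1.\<close>
    then have Ay: "A y = 0 \<or> A y = 1" using A unfolding zero_one_matrix_def by auto
    have mod_index: "(\<lambda>l\<in>{..<d}. i l mod k l) \<in> index_set d k" using k by (auto simp: index_set_def)
    have kron: "kronecker_product d (\<lambda>_. p) P k (all_ones_matrix d k) i = (if P b = 1 then 1 else 0)"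
      using i mod_index by (simp add: kronecker_product_def all_ones_matrix_def b_def)
    have "A y = 1" if "P b = 1"
    proof -
      have "b \<in> index_set d (\<lambda>_. p)" using g_in[OF _ il] by (auto simp: b_def index_set_def)
      then have "b \<in> x ` {..<p}" using that by (simp add: x(2)[symmetric])
      then obtain j where j: "j < p" "b = x j" by auto
      have "g l (i l) \<in> S j l" if l: "l < d" for l
      proof -
        have "i l div k l = x j l" using fun_cong[OF j(2), of l] l by (simp add: b_def)
        then show ?thesis using g_in[OF l il[OF l]] \<sigma>_x[OF l j(1)] by simp
      qed
      then have "y \<in> PiE {..<d} (S j)" unfolding y by auto
      then show ?thesis using S_box[OF j(1)] by (auto simp: X_def)
    qed
    then show "kronecker_product d (\<lambda>_. p) P k (all_ones_matrix d k) i = submatrix d U A i \<or>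
      submatrix d U A i = 1 \<and> kronecker_product d (\<lambda>_. p) P k (all_ones_matrix d k) i = 0"
      using Ay unfolding sub kron by auto
  qed
  then show ?thesis unfolding contains_matrix_def using U_card U_sub by blast
qed

text \<open>A single one \<open>b\<close> of \<open>P\<close> suffices: its block in the product is
  all ones, and the selected values at the positions \<open>b l * k l + r\<close> span the box. So a
  matrix without boxes avoids the product.\<close>

lemma box_if_contains_kronecker:
  assumes "contains_matrix d (\<lambda>_. n) A (\<lambda>l. p * k l)
      (kronecker_product d (\<lambda>_. p) P k (all_ones_matrix d k))"
    and b: "b \<in> index_set d (\<lambda>_. p)" "P b = 1" and k: "\<And>l. l < d \<Longrightarrow> k l > 0"
  shows "has_box {..<d} k {i \<in> index_set d (\<lambda>_. n). A i = 1}"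
proof -
  obtain U where U: "\<And>l. l < d \<Longrightarrow> U l \<subseteq> {..<n}" "\<And>l. l < d \<Longrightarrow> card (U l) = p * k l"
    and zeros: "ones_to_zeros d (\<lambda>l. p * k l) (submatrix d U A)
      (kronecker_product d (\<lambda>_. p) P k (all_ones_matrix d k))"
    using assms(1) unfolding contains_matrix_def by blast
  have U_fin: "finite (U l)" if "l < d" for l using U(1)[OF that] finite_subset by blast
  have bp: "b l < p" if "l < d" for l using b that by (auto simp: index_set_def PiE_iff)
  have shape: "index_set d (\<lambda>l. card (U l)) = index_set d (\<lambda>l. p * k l)"
    unfolding index_set_def using U(2) by (intro PiE_cong) auto
  have lt: "b l * k l + r < p * k l" if "l < d" "r < k l" for l r
  proof -
    have "b l * k l + r < Suc (b l) * k l" using that by simp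
    also have "\<dots> \<le> p * k l" using bp[OF that(1)] by (intro mult_right_mono) auto
    finally show ?thesis .
  qed
  define S where "S l = (\<lambda>r. enumerate (U l) (b l * k l + r)) ` {..<k l}" for l
  have "card (S l) = k l" if l: "l < d" for l
  proof -
    have "inj_on (\<lambda>r. enumerate (U l) (b l * k l + r)) {..<k l}"
    proof (rule inj_onI)
      fix r r' assume "r \<in> {..<k l}" "r' \<in> {..<k l}"
        and eq: "enumerate (U l) (b l * k l + r) = enumerate (U l) (b l * k l + r')"
      then have in_range: "b l * k l + r \<in> {..<card (U l)}" "b l * k l + r' \<in> {..<card (U l)}"
        using lt[OF l] U(2)[OF l] by auto
      have "b l * k l + r = b l * k l + r'"
        by (rule inj_onD[OF bij_betw_imp_inj_on[OF finite_bij_enumerate[OF U_fin[OF l]]] eq in_range])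
      then show "r = r'" by simp
    qed
    then show ?thesis by (simp add: S_def card_image)
  qed
  moreover have "y \<in> index_set d (\<lambda>_. n) \<and> A y = 1" if y: "y \<in> PiE {..<d} S" for y
  proof -
    have "\<forall>l\<in>{..<d}. \<exists>r. r < k l \<and> y l = enumerate (U l) (b l * k l + r)"
      using y unfolding S_def PiE_iff by blast
    from bchoice[OF this] obtain r
      where r: "\<And>l. l < d \<Longrightarrow> r l < k l \<and> y l = enumerate (U l) (b l * k l + r l)" by auto
    define i where "i = (\<lambda>l\<in>{..<d}. b l * k l + r l)"
    have i: "i \<in> index_set d (\<lambda>l. p * k l)" using lt r by (auto simp: i_def index_set_def)
    have y_eq: "(\<lambda>l\<in>{..<d}. enumerate (U l) (i l)) = y"
      using r y by (intro extensionalityI[of _ "{..<d}"]) (auto simp: i_def PiE_def)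
    have "(\<lambda>l\<in>{..<d}. i l div k l) = b"
      using r k b(1) by (intro extensionalityI[of _ "{..<d}"]) (auto simp: i_def index_set_def PiE_def)
    moreover have "(\<lambda>l\<in>{..<d}. i l mod k l) \<in> index_set d k" using k by (auto simp: index_set_def)
    ultimately have "kronecker_product d (\<lambda>_. p) P k (all_ones_matrix d k) i = 1"
      using i b(2) by (simp add: kronecker_product_def all_ones_matrix_def)
    then have "submatrix d U A i = 1" using zeros i unfolding ones_to_zeros_def by fastforce
    then have "A y = 1" using i y_eq by (simp add: submatrix_def shape)
    moreover have "y l < n" if l: "l < d" for l
    proof -
      have "y l \<in> U l" using r[OF l] lt[OF l] U(2)[OF l] U_fin[OF l] by (auto intro!: finite_enumerate_in_set)
      then show ?thesis using U(1)[OF l] by auto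
    qed
    ultimately show ?thesis using y by (auto simp: index_set_def PiE_iff)
  qed
  ultimately show ?thesis unfolding has_box_def by (intro exI[of _ S]) auto
qed

section \<open>Assembling the two bounds\<close>

theorem theorem2p5:
  fixes d p :: nat
    and P :: "(nat \<Rightarrow> nat) \<Rightarrow> nat"
    and k :: "nat \<Rightarrow> nat"
  assumes "p > 0"
    and "permutation_matrix d p P"
    and "\<And>l. l < d \<Longrightarrow> k l > 0"
    and "card {l. l < d \<and> k l > 1} \<ge> 2"
  shows "\<exists>C1 C2 :: real. C1 > 0 \<and> C2 > 0 \<and>
    (\<forall>n::nat. n > 0 \<longrightarrow>
      C1 * real n powr (real d - beta d k)
        \<le> real (max_ones n (\<lambda>l. p * k l)
                  (kronecker_product d (\<lambda>_. p) P k (all_ones_matrix d k)) d)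
      \<and> real (max_ones n (\<lambda>l. p * k l)
                  (kronecker_product d (\<lambda>_. p) P k (all_ones_matrix d k)) d)
        \<le> C2 * real n powr (real d - alpha d k))"
proof -
  define B where "B = kronecker_product d (\<lambda>_. p) P k (all_ones_matrix d k)"
  define L where "L = {l. l < d \<and> k l > 1}"
  have d: "d > 0"
  proof (rule ccontr)
    assume "\<not> d > 0"
    then have "L = {}" by (auto simp: L_def)
    moreover have "card L \<ge> 2" using assms(4) by (simp only: L_def)
    ultimately show False by simp
  qed
  obtain x where x_ones: "(\<forall>j<p. x j \<in> index_set d (\<lambda>_. p)) \<and>
      {i \<in> index_set d (\<lambda>_. p). P i = 1} = x ` {..<p} \<and>
      (\<forall>l<d. bij_betw (\<lambda>j. x j l) {..<p} {..<p})"
    using permutation_matrix_ones[OF assms(2) d] by (rule exE)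
  note x = x_ones[THEN conjunct1, rule_format] x_ones[THEN conjunct2, THEN conjunct1]
    x_ones[THEN conjunct2, THEN conjunct2, rule_format]
  have kD: "\<And>l. l \<in> {..<d} \<Longrightarrow> k l > 0" using assms(3) by simp
  have "Max (k ` {..<d}) \<in> k ` {..<d}" using d by (intro Max_in) auto
  \<comment> \<open>Leaving out a largest \<open>k m\<close> gives the box theorem its best
    exponent, namely \<open>alpha\<close>.\<close>
  then obtain m where m: "m < d" "k m = Max (k ` {..<d})" by auto
  have "\<exists>l\<in>L. l \<noteq> m"
  proof (rule ccontr)
    assume "\<not> (\<exists>l\<in>L. l \<noteq> m)"
    then have "L \<subseteq> {m}" by auto
    then have "card L \<le> 1" using card_mono[of "{m}" L] by simp
    moreover have "card L \<ge> 2" using assms(4) by (simp only: L_def)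
    ultimately show False by simp
  qed
  then obtain l where l: "l < d" "k l > 1" "l \<noteq> m" by (auto simp: L_def)
  have alpha: "alpha d k = 1 / (\<Prod>i\<in>{..<d} - {m}. real (k i))"
  proof -
    have "(\<Prod>i<d. real (k i)) = k m * (\<Prod>i\<in>{..<d} - {m}. real (k i))"
      using m(1) by (intro prod.remove) auto
    then show ?thesis using assms(3)[OF m(1)] unfolding alpha_def m(2)[symmetric] by simp
  qed
  have prod2: "(\<Prod>i\<in>{..<d}. k i) \<ge> 2"
  proof -
    have "(\<Prod>i\<in>{..<d}. k i) = k l * (\<Prod>i\<in>{..<d} - {l}. k i)"
      using l(1) by (intro prod.remove) auto
    moreover have "(\<Prod>i\<in>{..<d} - {l}. k i) \<ge> 1"
      using assms(3) by (intro prod_ge_1) (simp add: Suc_le_eq)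
    ultimately show ?thesis using l(2) mult_le_mono[of 2 "k l" 1] by simp
  qed
  have x_less: "x j l < p" if "l \<in> {..<d}" "j < p" for l j
    using x(1)[OF that(2)] that(1) by (auto simp: index_set_def PiE_iff)
  obtain C where C: "C > 0 \<and> (\<forall>n>0. \<forall>A. A \<subseteq> PiE {..<d} (\<lambda>_. {..<n}) \<longrightarrow>
      \<not> has_blowup {..<d} p (\<lambda>l j. x j l) k A \<longrightarrow>
      card A \<le> C * real n powr (card {..<d} - alpha d k))"
    using blowup_upper_bound[of "{..<d}" p "\<lambda>l j. x j l" k m l, OF _ x_less assms(1) kD] m l
    unfolding alpha by (elim exE meta_impE) simp_all
  have "1 / 4 * real n powr (real d - beta d k) \<le> max_ones n (\<lambda>l. p * k l) B d
    \<and> max_ones n (\<lambda>l. p * k l) B d \<le> C * real n powr (real d - alpha d k)" if n: "n > 0" for n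
  proof -
    define M where "M = {num_ones d (\<lambda>_. n) A | A.
      zero_one_matrix d (\<lambda>_. n) A \<and> avoids_matrix d (\<lambda>_. n) A (\<lambda>l. p * k l) B}"
    have max: "max_ones n (\<lambda>l. p * k l) B d = Max M" by (simp add: max_ones_def M_def)
    have "finite (index_set d (\<lambda>_. n) \<rightarrow>\<^sub>E {0, 1 :: nat})"
      by (intro finite_PiE) (auto simp: index_set_def intro: finite_PiE)
    then have finM: "finite M"
      by (rule finite_surj[of _ _ "num_ones d (\<lambda>_. n)"]) (auto simp: M_def zero_one_matrix_def)
    obtain A where A: "A \<subseteq> PiE {..<d} (\<lambda>_. {..<n})" "\<not> has_box {..<d} k A"
      "1 / 4 * real n powr (card {..<d} - ((\<Sum>l\<in>{..<d}. real (k l)) - card {..<d})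
          / ((\<Prod>l\<in>{..<d}. real (k l)) - 1)) \<le> card A"
      using box_lower_bound[of "{..<d}" k n, OF _ kD prod2 n] by auto
    define a where "a = (\<lambda>i\<in>index_set d (\<lambda>_. n). if i \<in> A then 1 else 0 :: nat)"
    have a: "zero_one_matrix d (\<lambda>_. n) a" by (auto simp: a_def zero_one_matrix_def)
    have ones: "{i \<in> index_set d (\<lambda>_. n). a i = 1} = A"
      using A(1) by (auto simp: a_def index_set_def)
    \<comment> \<open>\<open>p > 0\<close> provides a one of \<open>P\<close>, whose block would be
      a box.\<close>
    have "x 0 \<in> index_set d (\<lambda>_. p)" "P (x 0) = 1" using x(2) assms(1) by auto
    then have "avoids_matrix d (\<lambda>_. n) a (\<lambda>l. p * k l) B"
      using A(2) box_if_contains_kronecker[of d n a p k P "x 0"] assms(3) ones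
      unfolding B_def by auto
    then have cardA: "card A \<in> M" unfolding M_def using a ones by (auto simp: num_ones_def)
    then have "card A \<le> Max M" using finM by simp
    then have lower: "1 / 4 * real n powr (real d - beta d k) \<le> Max M"
      using A(3) by (simp add: beta_def)
    \<comment> \<open>The matrix from the lower bound shows that \<open>M\<close> is nonempty, so
      the maximum is attained by some \<open>A'\<close>.\<close>
    have "Max M \<in> M" using finM cardA by (intro Max_in) auto
    then obtain A' where A': "Max M = num_ones d (\<lambda>_. n) A'" "zero_one_matrix d (\<lambda>_. n) A'"
      "avoids_matrix d (\<lambda>_. n) A' (\<lambda>l. p * k l) B" unfolding M_def by blast
    define X where "X = {i \<in> index_set d (\<lambda>_. n). A' i = 1}"
    have "\<not> has_blowup {..<d} p (\<lambda>l j. x j l) k X"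
      using A'(3) contains_kronecker_if_blowup[OF A'(2) x assms(3)] unfolding B_def X_def by auto
    moreover have "X \<subseteq> PiE {..<d} (\<lambda>_. {..<n})" by (auto simp: X_def index_set_def)
    ultimately have "card X \<le> C * real n powr (card {..<d} - alpha d k)" using C n by blast
    then show ?thesis using lower unfolding max A'(1) num_ones_def X_def by simp
  qed
  then show ?thesis using C unfolding B_def by (intro exI[of _ "1 / 4"] exI[of _ C]) auto
qed

end
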